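(* Let $f,g$ be two bounded functions in $h^{2}(\mathbb{T}^{2})$. Then $\widehat{T}_f\widehat{T}_g=\widehat{T}_g\widehat{T}_f$ if and only if one of the following conditions is satisfied: (I) $f_{+}$ and $g_{+}$ are functions of the one variable $z_{1}$, and $f_{-}$ and $g_{-}$ are functions of the one variable $z_{2}$; (II) $f_{+}$ and $g_{+}$ are functions of the one variable $z_{2}$, and $f_{-}$ and $g_{-}$ are functions of the one variable $z_{1}$; (III) a nontrivial linear combination of $f$ and $g$ is constant, i.e. there are $\alpha,\beta\in\mathbb{C}$, not both zero, such that $\alpha f+\beta g$ is constant.
   Context: $\mathbb{T}$ is the unit circle in $\mathbb{C}$, $\mathbb{T}^2=\mathbb{T}\times\mathbb{T}$ has points $z=(z_1,z_2)$, and $d\sigma$ is the normalized Haar measure on $\mathbb{T}^2$. $H^2(\mathbb{T}^2)$ is the closure of the analytic polynomials (in $z_1,z_2$) in $L^2(\mathbb{T}^2,d\sigma)$. The pluriharmonic Hardy space is $h^{2}(\mathbb{T}^{2})=H^{2}(\mathbb{T}^{2})+\overline{H^{2}(\mathbb{T}^{2})}$, a closed subspace of $L^2(\mathbb{T}^2,d\sigma)$ with the $L^2$ inner product. Let $Q$ be the orthogonal projection of $L^2(\mathbb{T}^2)$ onto $h^2(\mathbb{T}^2)$ and $P$ the orthogonal projection of $L^2(\mathbb{T}^2)$ onto $H^2(\mathbb{T}^2)$. For $f\in L^2(\mathbb{T}^2)$ put $f_{+}=Pf$ and $f_{-}=(Q-P)f$. For $f\in L^{2}(\mathbb{T}^{2})$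 the Toeplitz operator $\widehat{T}_f$ on $h^2(\mathbb{T}^2)$ is densely defined by $\widehat{T}_f h=Q(fh)$ for polynomials $h\in h^2(\mathbb{T}^2)$; if $f$ is bounded (i.e. in $L^\infty(\mathbb{T}^2)$), it is a bounded operator given by $\widehat{T}_f h=Q(fh)$ for all $h\in h^2(\mathbb{T}^2)$. "Function of the one variable $z_i$" means depending only on $z_i$ (almost everywhere); constants are included. *)

theory Defs
  imports "HOL-Analysis.Analysis"
begin

text \<open>
  Elements of \<open>L\<^sup>2\<close> are represented by functions rather than by classes of functions.
  All sets of functions below are closed under modification on null sets, and every
  identity between functions is to be read almost everywhere.
\<close>

text \<open>The normalized Haar measure of the circle is normalized arc length, i.e. the
  image of the uniform distribution on \<open>[0, 2\<pi>]\<close> under \<open>t \<mapsto> exp (i t)\<close>.\<close>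

definition circle_measure :: "complex measure" where
  "circle_measure =
     distr (uniform_measure lborel {0..2 * pi}) (restrict_space borel (sphere 0 1)) cis"

definition torus_measure :: "(complex \<times> complex) measure" where
  "torus_measure = circle_measure \<Otimes>\<^sub>M circle_measure"

definition L2 :: "'a measure \<Rightarrow> ('a \<Rightarrow> complex) set" where
  "L2 M = {f. f \<in> borel_measurable M \<and> integrable M (\<lambda>x. (cmod (f x))\<^sup>2)}"

definition Linf :: "'a measure \<Rightarrow> ('a \<Rightarrow> complex) set" where
  "Linf M = {f. f \<in> borel_measurable M \<and> (\<exists>C. AE x in M. cmod (f x) \<le> C)}"

definition L2_inner :: "'a measure \<Rightarrow> ('a \<Rightarrow> complex) \<Rightarrow> ('a \<Rightarrow> complex) \<Rightarrow> complex" where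
  "L2_inner M f g = (LINT x|M. f x * cnj (g x))"

definition L2_norm :: "'a measure \<Rightarrow> ('a \<Rightarrow> complex) \<Rightarrow> real" where
  "L2_norm M f = sqrt (LINT x|M. (cmod (f x))\<^sup>2)"

definition L2_closure :: "'a measure \<Rightarrow> ('a \<Rightarrow> complex) set \<Rightarrow> ('a \<Rightarrow> complex) set" where
  "L2_closure M S = {f \<in> L2 M. \<forall>\<epsilon>>0. \<exists>p\<in>S. L2_norm M (\<lambda>x. f x - p x) < \<epsilon>}"

text \<open>
  The orthogonal projection of \<open>f \<in> L2 M\<close> onto a closed subspace \<open>S\<close>: the
  element of \<open>S\<close>, unique up to null sets, that differs from \<open>f\<close> by a function orthogonal
  to \<open>S\<close>. The choice operator only selects a representative; the characterizing
  property, hence the selected representative, depends only on the class of \<open>f\<close>.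
\<close>

definition L2_proj :: "'a measure \<Rightarrow> ('a \<Rightarrow> complex) set \<Rightarrow> ('a \<Rightarrow> complex) \<Rightarrow> ('a \<Rightarrow> complex)" where
  "L2_proj M S f = (SOME p. p \<in> S \<and> (\<forall>q\<in>S. L2_inner M (\<lambda>x. f x - p x) q = 0))"

definition analytic_polys :: "(complex \<times> complex \<Rightarrow> complex) set" where
  "analytic_polys =
     {p. \<exists>(N::nat) (c :: nat \<Rightarrow> nat \<Rightarrow> complex).
           p = (\<lambda>z. \<Sum>m\<le>N. \<Sum>n\<le>N. c m n * fst z ^ m * snd z ^ n)}"

definition hardy2 :: "(complex \<times> complex \<Rightarrow> complex) set" where
  "hardy2 = L2_closure torus_measure analytic_polys"

definition plh_hardy2 :: "(complex \<times> complex \<Rightarrow> complex) set" where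
  "plh_hardy2 = {\<lambda>z. u z + cnj (v z) | u v. u \<in> hardy2 \<and> v \<in> hardy2}"

definition projP :: "(complex \<times> complex \<Rightarrow> complex) \<Rightarrow> (complex \<times> complex \<Rightarrow> complex)" where
  "projP = L2_proj torus_measure hardy2"

definition projQ :: "(complex \<times> complex \<Rightarrow> complex) \<Rightarrow> (complex \<times> complex \<Rightarrow> complex)" where
  "projQ = L2_proj torus_measure plh_hardy2"

definition plus_part :: "(complex \<times> complex \<Rightarrow> complex) \<Rightarrow> (complex \<times> complex \<Rightarrow> complex)" where
  "plus_part f = projP f"

definition minus_part :: "(complex \<times> complex \<Rightarrow> complex) \<Rightarrow> (complex \<times> complex \<Rightarrow> complex)" where
  "minus_part f = (\<lambda>z. projQ f z - projP f z)"

text \<open>For bounded \<open>f\<close> this is the Toeplitz operator on all of \<open>plh_hardy2\<close>; for unbounded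
  \<open>f\<close> it is meaningful only where \<open>f h\<close> is square integrable.\<close>

definition toeplitz :: "(complex \<times> complex \<Rightarrow> complex) \<Rightarrow>
    (complex \<times> complex \<Rightarrow> complex) \<Rightarrow> (complex \<times> complex \<Rightarrow> complex)" where
  "toeplitz f h = projQ (\<lambda>z. f z * h z)"

definition depends_only_on_z1 :: "(complex \<times> complex \<Rightarrow> complex) \<Rightarrow> bool" where
  "depends_only_on_z1 F \<longleftrightarrow>
     (\<exists>\<phi> \<in> borel_measurable circle_measure. AE z in torus_measure. F z = \<phi> (fst z))"

definition depends_only_on_z2 :: "(complex \<times> complex \<Rightarrow> complex) \<Rightarrow> bool" where
  "depends_only_on_z2 F \<longleftrightarrow>
     (\<exists>\<phi> \<in> borel_measurable circle_measure. AE z in torus_measure. F z = \<phi> (snd z))"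

end

theory Submission
  imports Defs
begin

text \<open>
  Write \<open>F k\<close> and \<open>G k\<close>, \<open>k \<in> \<int>\<^sup>2\<close>, for the Fourier coefficients of \<open>f\<close> and \<open>g\<close>. Functions
  in the pluriharmonic Hardy space have their frequencies in \<open>\<Gamma> = \<nat>\<^sup>2 \<union> (- \<nat>\<^sup>2)\<close>
  (\<open>plh_freqs\<close> below), so the
  Toeplitz operator of \<open>f\<close> has the matrix \<open>F (j - k)\<close>, \<open>j, k \<in> \<Gamma>\<close>. The operators of
  multiplication by \<open>f\<close> and by \<open>g\<close> on all of \<open>L\<^sup>2\<close> commute; hence the Toeplitz operators
  commute iff what the projection discards, namely the passage through frequencies \<open>l\<close>
  outside \<open>\<Gamma>\<close>, is symmetric in \<open>f\<close> and \<open>g\<close> (lemma \<open>toeplitz_commute_iff\<close>). Tested on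
  characters this says
  \<open>(\<Sum>l \<notin> \<Gamma>. F (j - l) * G (l - k) - G (j - l) * F (l - k)) = 0\<close> for all \<open>j, k \<in> \<Gamma>\<close>.
  The constant terms \<open>F 0\<close>, \<open>G 0\<close> never occur here.

  Let \<open>u k = (F k, G k)\<close>, so that the summand is the determinant of \<open>u (j - l)\<close> and
  \<open>u (l - k)\<close>. Two families of these equations contain all the information.

  \<^item> For \<open>j \<in> \<nat>\<^sup>2\<close> and \<open>k \<in> - \<nat>\<^sup>2\<close> the sums are finite and involve only \<open>u\<close> on \<open>\<nat>\<^sup>2\<close>.
    With \<open>j\<close> on an axis, neighbouring equations differ by one coefficient of a product of
    power series in one variable. Comparing lowest coefficients shows that the vectors
    \<open>u p\<close>, \<open>0 \<noteq> p \<in> \<nat>\<^sup>2\<close>, either lie on one line or vanish off one of the two axes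
    (\<open>commuting_coeffs_rows\<close>, \<open>analytic_trichotomy\<close>). Reflection gives the same alternative
    for \<open>- \<nat>\<^sup>2\<close>.

  \<^item> For \<open>j, k \<in> \<nat>\<^sup>2\<close> and fixed \<open>j - k\<close> the equations say that one summable family on
    \<open>\<nat>\<^sup>2\<close> has vanishing sums over all pairs of opposite open quadrants, which forces the
    family to vanish off the origin (\<open>opposite_quadrant_sums\<close>). Hence \<open>u p\<close> and \<open>u (- q)\<close>
    are parallel as soon as \<open>p, q \<in> \<nat>\<^sup>2\<close> are both positive in a common coordinate
    (\<open>commuting_coeffs_mixed\<close>).

  A finite case analysis of these facts leaves exactly the three conditions
  (\<open>commuting_coeffs_classification\<close>). Conversely, under each condition the sum over
  \<open>l \<notin> \<Gamma>\<close> vanishes term by term.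

  The analytic side rests on two facts about the closed span of a set of characters:
  Parseval's formula, which gives the convolution formula for the coefficients of a product
  (\<open>fourier_mult\<close>), and the Riesz-Fischer theorem, which shows that the orthogonal
  projections exist and act by truncating the Fourier coefficients.
\<close>

section \<open>The space of square integrable functions\<close>

lemma L2_measurable: "f \<in> L2 M \<Longrightarrow> f \<in> borel_measurable M"
  and L2_sq_integrable: "f \<in> L2 M \<Longrightarrow> integrable M (\<lambda>x. (cmod (f x))\<^sup>2)"
  by (auto simp: L2_def)

lemma borel_measurable_cnj [measurable]:
  "f \<in> borel_measurable M \<Longrightarrow> (\<lambda>x. cnj (f x)) \<in> borel_measurable M"
  by (rule borel_measurable_continuous_on) (auto intro: continuous_intros)

lemma L2_cnj: "f \<in> L2 M \<Longrightarrow> (\<lambda>x. cnj (f x)) \<in> L2 M"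
  by (auto simp: L2_def)

lemma L2_cmult: "f \<in> L2 M \<Longrightarrow> (\<lambda>x. c * f x) \<in> L2 M"
  by (auto simp: L2_def norm_mult power_mult_distrib)

lemma L2_add:
  assumes "f \<in> L2 M" "g \<in> L2 M"
  shows "(\<lambda>x. f x + g x) \<in> L2 M"
proof -
  have [measurable]: "f \<in> borel_measurable M" "g \<in> borel_measurable M"
    using assms by (auto simp: L2_def)
  have "integrable M (\<lambda>x. 2 * (cmod (f x))\<^sup>2 + 2 * (cmod (g x))\<^sup>2)"
    using assms by (auto simp: L2_def)
  moreover have "(cmod (f x + g x))\<^sup>2 \<le> 2 * (cmod (f x))\<^sup>2 + 2 * (cmod (g x))\<^sup>2" for x
  proof -
    have "(cmod (f x + g x))\<^sup>2 \<le> (cmod (f x) + cmod (g x))\<^sup>2"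
      by (intro power_mono norm_triangle_ineq) auto
    also have "\<dots> \<le> 2 * (cmod (f x))\<^sup>2 + 2 * (cmod (g x))\<^sup>2"
      using sum_squares_bound[of "cmod (f x)" "cmod (g x)"] by (simp add: power2_sum)
    finally show ?thesis .
  qed
  ultimately have "integrable M (\<lambda>x. (cmod (f x + g x))\<^sup>2)"
    by (auto elim!: Bochner_Integration.integrable_bound intro!: AE_I2)
  then show ?thesis by (auto simp: L2_def)
qed

lemma L2_diff: "f \<in> L2 M \<Longrightarrow> g \<in> L2 M \<Longrightarrow> (\<lambda>x. f x - g x) \<in> L2 M"
  using L2_add[of f M "\<lambda>x. (-1) * g x"] L2_cmult[of g M "-1"] by simp

lemma L2_zero: "(\<lambda>x. 0) \<in> L2 M"
  by (simp add: L2_def)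

lemma L2_sum:
  assumes "\<And>i. i \<in> I \<Longrightarrow> f i \<in> L2 M"
  shows "(\<lambda>x. \<Sum>i\<in>I. f i x) \<in> L2 M"
  using assms by (induction I rule: infinite_finite_induct) (auto intro: L2_add L2_zero)

lemma L2_mult_Linf:
  assumes "g \<in> Linf M" "f \<in> L2 M"
  shows "(\<lambda>x. g x * f x) \<in> L2 M"
proof -
  obtain C where C: "AE x in M. cmod (g x) \<le> C" and [measurable]: "g \<in> borel_measurable M"
    using assms(1) by (auto simp: Linf_def)
  have [measurable]: "f \<in> borel_measurable M"
    using assms by (auto simp: L2_def)
  have "integrable M (\<lambda>x. (cmod (of_real C * f x))\<^sup>2)"
    using L2_cmult[OF assms(2)] by (auto simp: L2_def)
  moreover have "(\<lambda>x. (cmod (g x * f x))\<^sup>2) \<in> borel_measurable M"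
    by measurable
  moreover have "AE x in M. norm ((cmod (g x * f x))\<^sup>2) \<le> norm ((cmod (of_real C * f x))\<^sup>2)"
    using C
  proof eventually_elim
    case (elim x)
    then have "(cmod (g x))\<^sup>2 \<le> C\<^sup>2" by (intro power_mono) auto
    then show ?case
      by (simp add: norm_mult power_mult_distrib mult_right_mono)
  qed
  ultimately have "integrable M (\<lambda>x. (cmod (g x * f x))\<^sup>2)"
    by (rule Bochner_Integration.integrable_bound)
  then show ?thesis by (auto simp: L2_def)
qed

lemma L2_mult_integrable:
  assumes "f \<in> L2 M" "g \<in> L2 M"
  shows "integrable M (\<lambda>x. f x * g x)"
proof -
  have [measurable]: "f \<in> borel_measurable M" "g \<in> borel_measurable M"
    using assms by (auto simp: L2_def)
  have "integrable M (\<lambda>x. (cmod (f x))\<^sup>2 + (cmod (g x))\<^sup>2)"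
    using assms by (auto simp: L2_def)
  moreover have "cmod (f x * g x) \<le> (cmod (f x))\<^sup>2 + (cmod (g x))\<^sup>2" for x
  proof -
    have "2 * (cmod (f x) * cmod (g x)) \<le> (cmod (f x))\<^sup>2 + (cmod (g x))\<^sup>2"
      using sum_squares_bound[of "cmod (f x)" "cmod (g x)"] by simp
    moreover have "0 \<le> cmod (f x) * cmod (g x)" by simp
    ultimately show ?thesis unfolding norm_mult by linarith
  qed
  ultimately show ?thesis
    by (auto elim!: Bochner_Integration.integrable_bound intro!: AE_I2)
qed

lemma L2_inner_integrable:
  "f \<in> L2 M \<Longrightarrow> g \<in> L2 M \<Longrightarrow> integrable M (\<lambda>x. f x * cnj (g x))"
  using L2_mult_integrable[OF _ L2_cnj] .

lemma L2_norm_nonneg [simp]: "0 \<le> L2_norm M f"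
  by (simp add: L2_norm_def)

lemma L2_norm_sq: "(L2_norm M f)\<^sup>2 = (LINT x|M. (cmod (f x))\<^sup>2)"
  by (simp add: L2_norm_def)

lemma L2_norm_sq_inner: "of_real ((L2_norm M f)\<^sup>2) = L2_inner M f f"
proof -
  have "L2_inner M f f = (LINT x|M. of_real ((cmod (f x))\<^sup>2))"
    unfolding L2_inner_def complex_norm_square by simp
  then show ?thesis by (simp only: L2_norm_sq integral_complex_of_real)
qed

lemma L2_inner_diff_left:
  assumes "f \<in> L2 M" "g \<in> L2 M" "h \<in> L2 M"
  shows "L2_inner M (\<lambda>x. f x - g x) h = L2_inner M f h - L2_inner M g h"
  unfolding L2_inner_def left_diff_distrib
  by (intro Bochner_Integration.integral_diff L2_inner_integrable assms)

lemma L2_inner_add_left: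
  assumes "f \<in> L2 M" "g \<in> L2 M" "h \<in> L2 M"
  shows "L2_inner M (\<lambda>x. f x + g x) h = L2_inner M f h + L2_inner M g h"
  unfolding L2_inner_def distrib_right
  by (intro Bochner_Integration.integral_add L2_inner_integrable assms)

lemma L2_inner_cmult_left: "L2_inner M (\<lambda>x. c * f x) h = c * L2_inner M f h"
  unfolding L2_inner_def by (simp add: mult.assoc)

lemma L2_inner_cnj: "cnj (L2_inner M f g) = L2_inner M g f"
  unfolding L2_inner_def Bochner_Integration.integral_cnj[symmetric] by (simp add: mult.commute)

lemma L2_inner_diff_right:
  assumes "f \<in> L2 M" "g \<in> L2 M" "h \<in> L2 M"
  shows "L2_inner M h (\<lambda>x. f x - g x) = L2_inner M h f - L2_inner M h g"
  by (metis L2_inner_cnj L2_inner_diff_left[OF assms] complex_cnj_diff)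

lemma L2_inner_cmult_right: "L2_inner M h (\<lambda>x. c * f x) = cnj c * L2_inner M h f"
  by (metis L2_inner_cnj L2_inner_cmult_left complex_cnj_mult)

lemma L2_inner_sum_right:
  assumes "\<And>i. i \<in> I \<Longrightarrow> f i \<in> L2 M" "h \<in> L2 M"
  shows "L2_inner M h (\<lambda>x. \<Sum>i\<in>I. f i x) = (\<Sum>i\<in>I. L2_inner M h (f i))"
  unfolding L2_inner_def cnj_sum sum_distrib_left
  by (intro Bochner_Integration.integral_sum L2_inner_integrable assms)

lemma L2_norm_diff_sq:
  assumes "f \<in> L2 M" "g \<in> L2 M"
  shows "(L2_norm M (\<lambda>x. f x - g x))\<^sup>2
         = (L2_norm M f)\<^sup>2 - 2 * Re (L2_inner M f g) + (L2_norm M g)\<^sup>2"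
proof -
  have "complex_of_real ((L2_norm M (\<lambda>x. f x - g x))\<^sup>2)
        = of_real ((L2_norm M f)\<^sup>2) - L2_inner M f g - (L2_inner M g f - of_real ((L2_norm M g)\<^sup>2))"
    unfolding L2_norm_sq_inner
    using assms by (simp add: L2_inner_diff_left L2_inner_diff_right L2_diff)
  also have "L2_inner M g f = cnj (L2_inner M f g)"
    by (simp add: L2_inner_cnj)
  finally have "Re (complex_of_real ((L2_norm M (\<lambda>x. f x - g x))\<^sup>2))
      = Re (of_real ((L2_norm M f)\<^sup>2) - L2_inner M f g
            - (cnj (L2_inner M f g) - of_real ((L2_norm M g)\<^sup>2)))"
    by (rule arg_cong)
  then show ?thesis by simp
qed

lemma L2_norm_cmult: "L2_norm M (\<lambda>x. c * f x) = cmod c * L2_norm M f"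
  unfolding L2_norm_def by (simp add: norm_mult power_mult_distrib real_sqrt_mult)

lemma L2_Cauchy_Schwarz:
  assumes "f \<in> L2 M" "g \<in> L2 M"
  shows "cmod (L2_inner M f g) \<le> L2_norm M f * L2_norm M g"
proof -
  have [measurable]: "f \<in> borel_measurable M" "g \<in> borel_measurable M"
    using assms by (auto simp: L2_def)
  have sq: "(\<integral>\<^sup>+x. ennreal (cmod (u x)) ^ 2 \<partial>M) = ennreal ((L2_norm M u)\<^sup>2)" if "u \<in> L2 M" for u
    unfolding L2_norm_sq using L2_sq_integrable[OF that]
    by (simp add: ennreal_power nn_integral_eq_integral)
  have int: "integrable M (\<lambda>x. cmod (f x) * cmod (g x))"
    using integrable_norm[OF L2_inner_integrable[OF assms]] by (simp add: norm_mult)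
  have "ennreal ((LINT x|M. cmod (f x) * cmod (g x))\<^sup>2)
        = (\<integral>\<^sup>+x. ennreal (cmod (f x)) * ennreal (cmod (g x)) \<partial>M)\<^sup>2"
    using nn_integral_eq_integral[OF int]
    by (simp add: ennreal_mult flip: ennreal_power)
  also have "\<dots> \<le> (\<integral>\<^sup>+x. ennreal (cmod (f x)) ^ 2 \<partial>M) * (\<integral>\<^sup>+x. ennreal (cmod (g x)) ^ 2 \<partial>M)"
    by (rule Cauchy_Schwarz_nn_integral) auto
  also have "\<dots> = ennreal ((L2_norm M f * L2_norm M g)\<^sup>2)"
    by (simp add: sq assms power_mult_distrib ennreal_mult)
  finally have "(LINT x|M. cmod (f x) * cmod (g x))\<^sup>2 \<le> (L2_norm M f * L2_norm M g)\<^sup>2"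
    by simp
  then have "(LINT x|M. cmod (f x) * cmod (g x)) \<le> L2_norm M f * L2_norm M g"
    by (rule power2_le_imp_le) simp
  moreover have "cmod (L2_inner M f g) \<le> (LINT x|M. cmod (f x * cnj (g x)))"
    unfolding L2_inner_def by (rule integral_norm_bound)
  ultimately show ?thesis by (simp add: norm_mult)
qed

lemma L2_norm_diff_triangle:
  assumes "f \<in> L2 M" "g \<in> L2 M"
  shows "L2_norm M (\<lambda>x. f x - g x) \<le> L2_norm M f + L2_norm M g"
proof (rule power2_le_imp_le)
  have "- Re (L2_inner M f g) \<le> L2_norm M f * L2_norm M g"
    using L2_Cauchy_Schwarz[OF assms] abs_Re_le_cmod[of "L2_inner M f g"] by linarith
  then show "(L2_norm M (\<lambda>x. f x - g x))\<^sup>2 \<le> (L2_norm M f + L2_norm M g)\<^sup>2"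
    unfolding L2_norm_diff_sq[OF assms] by (simp add: power2_sum)
qed simp

lemma L2_norm_zero_AE:
  assumes "f \<in> L2 M" "L2_norm M f = 0"
  shows "AE x in M. f x = 0"
proof -
  have "(LINT x|M. (cmod (f x))\<^sup>2) = 0"
    using assms(2) by (simp flip: L2_norm_sq)
  then have "AE x in M. (cmod (f x))\<^sup>2 = 0"
    by (subst (asm) integral_nonneg_eq_0_iff_AE) (auto intro: L2_sq_integrable assms)
  then show ?thesis by simp
qed

lemma (in finite_measure) L2_bounded:
  assumes [measurable]: "f \<in> borel_measurable M" and "\<And>x. x \<in> space M \<Longrightarrow> cmod (f x) \<le> C"
  shows "f \<in> L2 M"
proof -
  have "integrable M (\<lambda>x. (cmod (f x))\<^sup>2)"
    by (rule integrable_const_bound[where B = "C\<^sup>2"])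
       (auto intro!: AE_I2 power_mono assms(2))
  then show ?thesis by (simp add: L2_def)
qed

lemma (in finite_measure) L2_integrable: "f \<in> L2 M \<Longrightarrow> integrable M f"
  using L2_mult_integrable[of f M "\<lambda>x. 1"] L2_bounded[of "\<lambda>x. 1" 1] by simp

lemma (in finite_measure) L1_le_L2:
  assumes "f \<in> L2 M"
  shows "(LINT x|M. cmod (f x)) \<le> L2_norm M f * L2_norm M (\<lambda>x. 1)"
proof -
  have "(\<lambda>x. complex_of_real (cmod (f x))) \<in> L2 M"
    using assms by (auto simp: L2_def)
  moreover have "(\<lambda>x. 1) \<in> L2 M"
    by (rule L2_bounded) auto
  ultimately have "cmod (L2_inner M (\<lambda>x. complex_of_real (cmod (f x))) (\<lambda>x. 1))
      \<le> L2_norm M (\<lambda>x. complex_of_real (cmod (f x))) * L2_norm M (\<lambda>x. 1)"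
    by (rule L2_Cauchy_Schwarz)
  then show ?thesis
    by (simp add: L2_inner_def L2_norm_def)
qed

text \<open>Convergence in mean on a finite measure space gives a subsequence that converges almost
  everywhere; Fatou's lemma, applied along that subsequence, shows that its pointwise limit
  is also the limit in norm.\<close>

theorem (in finite_measure) L2_complete:
  assumes L2: "\<And>n. u n \<in> L2 M"
    and cauchy: "\<And>e. e > 0 \<Longrightarrow> \<exists>N. \<forall>m\<ge>N. \<forall>n\<ge>N. L2_norm M (\<lambda>x. u m x - u n x) < e"
  shows "\<exists>v\<in>L2 M. (\<lambda>n. L2_norm M (\<lambda>x. v x - u n x)) \<longlonglongrightarrow> 0"
proof -
  have [measurable]: "u n \<in> borel_measurable M" for n
    using L2 by (auto simp: L2_def)
  define c where "c = L2_norm M (\<lambda>x. 1) + 1"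
  have "c > 0" by (simp add: c_def add_nonneg_pos)
  obtain r where r: "strict_mono r" and ae: "AE x in M. Cauchy (\<lambda>i. u (r i) x)"
  proof (rule cauchy_L1_AE_cauchy_subseq[of M u])
    show "integrable M (u n)" for n
      using L2 by (rule L2_integrable)
    fix e :: real assume "e > 0"
    with \<open>c > 0\<close> have "e / c > 0" by simp
    then obtain N where N: "\<And>m n. m \<ge> N \<Longrightarrow> n \<ge> N \<Longrightarrow> L2_norm M (\<lambda>x. u m x - u n x) < e / c"
      using cauchy by blast
    have "LINT x|M. norm (u m x - u n x) < e" if "m \<ge> N" "n \<ge> N" for m n
    proof -
      have "LINT x|M. norm (u m x - u n x) \<le> L2_norm M (\<lambda>x. u m x - u n x) * L2_norm M (\<lambda>x. 1)"
        by (intro L1_le_L2 L2_diff L2)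
      also have "\<dots> \<le> L2_norm M (\<lambda>x. u m x - u n x) * c"
        by (intro mult_left_mono) (auto simp: c_def)
      also have "\<dots> < e"
        using N[OF that] \<open>c > 0\<close> by (simp add: field_simps)
      finally show ?thesis .
    qed
    then show "\<exists>N. \<forall>i\<ge>N. \<forall>j\<ge>N. LINT x|M. norm (u i x - u j x) < e" by blast
  qed (rule that)
  define v where "v x = lim (\<lambda>i. u (r i) x)" for x
  have v_lim: "AE x in M. (\<lambda>i. u (r i) x) \<longlonglongrightarrow> v x"
    using ae unfolding v_def by eventually_elim (simp add: Cauchy_convergent_iff convergent_LIMSEQ_iff)
  have [measurable]: "v \<in> borel_measurable M"
    unfolding v_def by measurable
  have bound: "(\<integral>\<^sup>+x. ennreal ((cmod (v x - u n x))\<^sup>2) \<partial>M) \<le> ennreal (e\<^sup>2)"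
    if "e > 0" and N: "\<forall>m\<ge>N. \<forall>n\<ge>N. L2_norm M (\<lambda>x. u m x - u n x) < e" and "n \<ge> N"
    for e N n
  proof -
    have "(\<integral>\<^sup>+x. ennreal ((cmod (v x - u n x))\<^sup>2) \<partial>M)
        = (\<integral>\<^sup>+x. liminf (\<lambda>i. ennreal ((cmod (u (r i) x - u n x))\<^sup>2)) \<partial>M)"
    proof (rule nn_integral_cong_AE, use v_lim in eventually_elim)
      case (elim x)
      have "(\<lambda>i. ennreal ((cmod (u (r i) x - u n x))\<^sup>2)) \<longlonglongrightarrow> ennreal ((cmod (v x - u n x))\<^sup>2)"
        by (intro tendsto_ennrealI tendsto_intros elim)
      from lim_imp_Liminf[OF sequentially_bot this] show ?case by (rule sym)
    qed
    also have "\<dots> \<le> liminf (\<lambda>i. \<integral>\<^sup>+x. ennreal ((cmod (u (r i) x - u n x))\<^sup>2) \<partial>M)"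
      by (rule nn_integral_liminf) simp
    also have "\<dots> \<le> ennreal (e\<^sup>2)"
    proof (rule Liminf_le)
      show "\<forall>\<^sub>F i in sequentially. (\<integral>\<^sup>+x. ennreal ((cmod (u (r i) x - u n x))\<^sup>2) \<partial>M) \<le> ennreal (e\<^sup>2)"
        using eventually_ge_at_top[of N]
      proof eventually_elim
        case (elim i)
        then have "r i \<ge> N" using seq_suble[OF r, of i] by linarith
        then have "L2_norm M (\<lambda>x. u (r i) x - u n x) < e" using N \<open>n \<ge> N\<close> by blast
        then have "(L2_norm M (\<lambda>x. u (r i) x - u n x))\<^sup>2 \<le> e\<^sup>2"
          by (intro power_mono) auto
        then show ?case
          unfolding L2_norm_sq
          by (subst nn_integral_eq_integral)
             (auto intro!: ennreal_leI L2_sq_integrable[OF L2_diff] L2)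
      qed
    qed simp
    finally show ?thesis .
  qed
  have diff_L2: "(\<lambda>x. v x - u n x) \<in> L2 M" and diff_norm: "L2_norm M (\<lambda>x. v x - u n x) \<le> e"
    if "e > 0" and N: "\<forall>m\<ge>N. \<forall>n\<ge>N. L2_norm M (\<lambda>x. u m x - u n x) < e" and "n \<ge> N"
    for e N n
  proof -
    note b = bound[OF that]
    have "integrable M (\<lambda>x. (cmod (v x - u n x))\<^sup>2)"
      using le_less_trans[OF b] by (intro integrableI_bounded) auto
    then show *: "(\<lambda>x. v x - u n x) \<in> L2 M" by (simp add: L2_def)
    have "(L2_norm M (\<lambda>x. v x - u n x))\<^sup>2 \<le> e\<^sup>2"
      using b unfolding L2_norm_sq
      by (subst (asm) nn_integral_eq_integral) (auto intro!: L2_sq_integrable[OF *])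
    then show "L2_norm M (\<lambda>x. v x - u n x) \<le> e"
      by (rule power2_le_imp_le) (use \<open>e > 0\<close> in simp)
  qed
  have "v \<in> L2 M"
  proof -
    obtain N where "\<forall>m\<ge>N. \<forall>n\<ge>N. L2_norm M (\<lambda>x. u m x - u n x) < 1"
      using cauchy[of 1] by auto
    then have "(\<lambda>x. v x - u N x) \<in> L2 M" by (intro diff_L2[of 1 N]) auto
    from L2_add[OF this L2[of N]] show ?thesis by simp
  qed
  moreover have "(\<lambda>n. L2_norm M (\<lambda>x. v x - u n x)) \<longlonglongrightarrow> 0"
  proof (rule LIMSEQ_I)
    fix e :: real assume "e > 0"
    then have "e / 2 > 0" by simp
    then obtain N where N: "\<forall>m\<ge>N. \<forall>n\<ge>N. L2_norm M (\<lambda>x. u m x - u n x) < e / 2"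
      using cauchy by blast
    have "norm (L2_norm M (\<lambda>x. v x - u n x) - 0) < e" if "n \<ge> N" for n
      using diff_norm[OF \<open>e / 2 > 0\<close> N that] \<open>e > 0\<close> by simp
    then show "\<exists>N. \<forall>n\<ge>N. norm (L2_norm M (\<lambda>x. v x - u n x) - 0) < e" by blast
  qed
  ultimately show ?thesis by blast
qed

section \<open>Fourier coefficients on the torus\<close>

lemma borel_measurable_power_int [measurable]:
  fixes f :: "'a \<Rightarrow> complex"
  assumes [measurable]: "f \<in> borel_measurable M"
  shows "(\<lambda>x. f x powi n) \<in> borel_measurable M"
  unfolding power_int_def by measurable

lemma space_circle_measure: "space circle_measure = sphere 0 1"
  by (simp add: circle_measure_def space_restrict_space)

lemma sets_circle_measure: "sets circle_measure = sets (restrict_space borel (sphere 0 1))"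
  by (simp add: circle_measure_def)

lemma circle_measurable_ident [measurable]: "(\<lambda>x. x) \<in> borel_measurable circle_measure"
  unfolding measurable_cong_sets[OF sets_circle_measure refl]
  by (rule measurable_restrict_space1) simp

lemma cis_measurable_circle:
  "cis \<in> measurable (uniform_measure lborel {0..2 * pi}) (restrict_space borel (sphere 0 1))"
proof (rule measurable_restrict_space2)
  have "cis \<in> borel_measurable borel"
    by (intro borel_measurable_continuous_onI continuous_intros)
  then show "cis \<in> measurable (uniform_measure lborel {0..2 * pi}) borel"
    by simp
qed auto

lemma finite_measure_circle: "finite_measure circle_measure"
proof -
  have "cis -` sphere 0 1 = UNIV" by auto
  then have "emeasure circle_measure (space circle_measure) = 1"
    unfolding space_circle_measure unfolding circle_measure_def
    by (subst emeasure_distr[OF cis_measurable_circle])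
       (auto simp: sets_restrict_space emeasure_uniform_measure divide_ennreal)
  then show "finite_measure circle_measure"
    by (intro finite_measureI) simp
qed

text \<open>Orthogonality of the monomials on the circle, by the fundamental theorem of calculus for
  \<open>cis (n t) / (i n)\<close>, whose values at \<open>0\<close> and \<open>2 \<pi>\<close> agree.\<close>

lemma circle_integral_powi: "(LINT x|circle_measure. x powi n) = of_bool (n = 0)"
proof -
  have unif: "uniform_measure lborel {0..2 * pi}
      = density lborel (\<lambda>t. ennreal (indicator {0..2 * pi} t / (2 * pi)))"
    unfolding uniform_measure_def
    by (intro density_cong) (auto simp: indicator_def divide_ennreal[of 1, simplified])
  have "(\<lambda>x::complex. x powi n) \<in> borel_measurable (restrict_space borel (sphere 0 1))"
    by (rule measurable_restrict_space1) measurable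
  then have "(LINT x|circle_measure. x powi n)
      = (LINT t|uniform_measure lborel {0..2 * pi}. cis t powi n)"
    unfolding circle_measure_def by (rule integral_distr[OF cis_measurable_circle])
  also have "\<dots> = (LINT t|lborel. (indicator {0..2 * pi} t / (2 * pi)) *\<^sub>R (cis t powi n))"
  proof -
    have "(\<lambda>t. cis t powi n) \<in> borel_measurable lborel"
      unfolding cis_power_int
      by (simp, intro borel_measurable_continuous_onI continuous_intros)
    then show ?thesis
      unfolding unif by (intro integral_density) auto
  qed
  also have "\<dots> = (LINT t|lborel. (1 / (2 * pi)) *\<^sub>R (indicator {0..2 * pi} t *\<^sub>R cis (of_int n * t)))"
    by (intro Bochner_Integration.integral_cong) (auto simp: cis_power_int)
  also have "\<dots> = (1 / (2 * pi)) *\<^sub>R (LINT t|lborel. indicator {0..2 * pi} t *\<^sub>R cis (of_int n * t))"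
    by (rule Bochner_Integration.integral_scaleR_right)
  also have "(LINT t|lborel. indicator {0..2 * pi} t *\<^sub>R cis (of_int n * t)) = of_bool (n = 0) * (2 * pi)"
  proof (cases "n = 0")
    case True
    then show ?thesis by (simp add: of_real_def)
  next
    case False
    have "(LINT t|lborel. indicator {0..2 * pi} t *\<^sub>R cis (of_int n * t))
        = cis (of_int n * (2 * pi)) / (\<i> * of_int n) - cis (of_int n * 0) / (\<i> * of_int n)"
    proof (rule integral_FTC_Icc)
      show "((\<lambda>t. cis (of_int n * t) / (\<i> * of_int n)) has_vector_derivative cis (of_int n * t))
              (at t within {0..2 * pi})" for t
      proof -
        have "((\<lambda>z. exp (\<i> * of_int n * z) / (\<i> * of_int n)) has_field_derivative
                exp (\<i> * of_int n * of_real t)) (at (of_real t))"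
          using False by (auto intro!: derivative_eq_intros)
        from has_vector_derivative_real_field[OF this] show ?thesis
          by (simp add: cis_conv_exp mult.assoc)
      qed
    qed (auto intro!: continuous_intros)
    also have "cis (of_int n * (2 * pi)) = 1"
      by (metis cis_multiple_2pi Ints_of_int mult.commute mult.left_commute)
    finally show ?thesis using False by simp
  qed
  finally show ?thesis by (simp add: scaleR_conv_of_real)
qed

interpretation circle: finite_measure circle_measure
  by (rule finite_measure_circle)

interpretation torus_pair: pair_sigma_finite circle_measure circle_measure ..

interpretation torus: finite_measure torus_measure
  unfolding torus_measure_def by (intro finite_measure_pair_measure finite_measure_circle)

lemma space_torus_measure: "space torus_measure = sphere 0 1 \<times> sphere 0 1"
  by (simp add: torus_measure_def space_pair_measure space_circle_measure)

lemma torus_measurable_fst: "\<phi> \<in> borel_measurable circle_measure \<Longrightarrow> (\<lambda>z. \<phi> (fst z)) \<in> borel_measurable torus_measure"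
  and torus_measurable_snd: "\<phi> \<in> borel_measurable circle_measure \<Longrightarrow> (\<lambda>z. \<phi> (snd z)) \<in> borel_measurable torus_measure"
  unfolding torus_measure_def
  by (auto intro: measurable_compose[OF measurable_fst] measurable_compose[OF measurable_snd])

definition character :: "int \<times> int \<Rightarrow> complex \<times> complex \<Rightarrow> complex" where
  "character k z = fst z powi fst k * snd z powi snd k"

lemma character_measurable [measurable]: "character k \<in> borel_measurable torus_measure"
  unfolding character_def by (intro borel_measurable_times torus_measurable_fst torus_measurable_snd) measurable

lemma norm_character: "z \<in> space torus_measure \<Longrightarrow> cmod (character k z) = 1"
  by (auto simp: character_def space_torus_measure norm_mult norm_power_int)

lemma character_L2: "character k \<in> L2 torus_measure"
  by (rule torus.L2_bounded[where C = 1]) (auto simp: norm_character)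

lemma character_Linf: "character k \<in> Linf torus_measure"
  unfolding Linf_def using norm_character by (auto intro!: exI[of _ 1] AE_I2)

lemma character_mult:
  assumes "z \<in> space torus_measure"
  shows "character k z * character l z = character (k + l) z"
proof -
  have "fst z \<noteq> 0" "snd z \<noteq> 0"
    using assms by (auto simp: space_torus_measure)
  then show ?thesis by (simp add: character_def power_int_add)
qed

lemma cnj_character:
  assumes "z \<in> space torus_measure"
  shows "cnj (character k z) = character (- k) z"
proof -
  have cnj_powi: "cnj (x powi n) = cnj x powi n" for x n
    by (simp add: power_int_def)
  have "cnj x powi n = x powi (- n)" if "cmod x = 1" for x and n :: int
  proof -
    have "x * cnj x = 1" using complex_norm_square[of x] that by simp
    then have "cnj x = inverse x" by (metis inverse_unique)
    then have "cnj x powi n = inverse x powi n" by (rule arg_cong)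
    also have "\<dots> = x powi (- n)" by (simp only: power_int_inverse power_int_minus)
    finally show ?thesis .
  qed
  then show ?thesis
    using assms by (simp add: character_def space_torus_measure mem_Times_iff cnj_powi)
qed

lemma torus_integral_product:
  assumes "integrable torus_measure (\<lambda>z. \<phi> (fst z) * \<psi> (snd z))"
  shows "(LINT z|torus_measure. \<phi> (fst z) * \<psi> (snd z))
    = (LINT x|circle_measure. \<phi> x) * (LINT y|circle_measure. \<psi> y :: complex)"
  using torus_pair.integral_fst'[OF assms[unfolded torus_measure_def]]
  by (simp add: torus_measure_def)

lemma integral_character: "(LINT z|torus_measure. character k z) = of_bool (k = 0)"
  using torus_integral_product[of "\<lambda>x. x powi fst k" "\<lambda>x. x powi snd k"]
    torus.L2_integrable[OF character_L2[of k]]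
  by (auto simp: character_def [abs_def] circle_integral_powi prod_eq_iff)

definition fourier :: "(complex \<times> complex \<Rightarrow> complex) \<Rightarrow> int \<times> int \<Rightarrow> complex" where
  "fourier f k = L2_inner torus_measure f (character k)"

lemma fourier_character: "fourier (character l) k = of_bool (k = l)"
proof -
  have "fourier (character l) k = (LINT z|torus_measure. character (l - k) z)"
    unfolding fourier_def L2_inner_def
    by (intro Bochner_Integration.integral_cong) (auto simp: cnj_character character_mult)
  then show ?thesis by (simp add: integral_character)
qed

lemma L2_norm_character: "L2_norm torus_measure (character k) = 1"
proof -
  have "complex_of_real ((L2_norm torus_measure (character k))\<^sup>2) = 1"
    using fourier_character[of k k] by (simp only: L2_norm_sq_inner fourier_def) simp
  then have "(L2_norm torus_measure (character k))\<^sup>2 = 1"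
    by (metis of_real_eq_1_iff)
  then show ?thesis
    using L2_norm_nonneg[of torus_measure "character k"] by (simp add: power2_eq_1_iff)
qed

lemma fourier_add: "f \<in> L2 torus_measure \<Longrightarrow> g \<in> L2 torus_measure \<Longrightarrow>
    fourier (\<lambda>z. f z + g z) k = fourier f k + fourier g k"
  and fourier_diff: "f \<in> L2 torus_measure \<Longrightarrow> g \<in> L2 torus_measure \<Longrightarrow>
    fourier (\<lambda>z. f z - g z) k = fourier f k - fourier g k"
  by (simp_all add: fourier_def L2_inner_add_left L2_inner_diff_left character_L2)

lemma fourier_cmult: "fourier (\<lambda>z. c * f z) k = c * fourier f k"
  by (simp add: fourier_def L2_inner_cmult_left)

lemma fourier_sum: "(\<And>i. i \<in> I \<Longrightarrow> f i \<in> L2 torus_measure) \<Longrightarrow>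
    fourier (\<lambda>z. \<Sum>i\<in>I. f i z) k = (\<Sum>i\<in>I. fourier (f i) k)"
  unfolding fourier_def L2_inner_def sum_distrib_right
  by (intro Bochner_Integration.integral_sum L2_inner_integrable character_L2)

lemma fourier_cong_AE:
  assumes "AE z in torus_measure. f z = g z" "f \<in> L2 torus_measure" "g \<in> borel_measurable torus_measure"
  shows "fourier f k = fourier g k"
proof -
  note [measurable] = L2_measurable[OF assms(2)] assms(3)
  show ?thesis unfolding fourier_def L2_inner_def
    by (rule integral_cong_AE) (use assms(1) in auto)
qed

lemma fourier_cnj: "fourier (\<lambda>z. cnj (f z)) k = cnj (fourier f (- k))"
proof -
  have "cnj (fourier f (- k)) = (LINT z|torus_measure. cnj (f z * cnj (character (- k) z)))"
    unfolding fourier_def L2_inner_def by (rule Bochner_Integration.integral_cnj[symmetric])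
  also have "\<dots> = fourier (\<lambda>z. cnj (f z)) k"
    unfolding fourier_def L2_inner_def
    by (intro Bochner_Integration.integral_cong) (auto simp: cnj_character)
  finally show ?thesis by simp
qed

lemma fourier_mult_character: "fourier (\<lambda>z. f z * character l z) k = fourier f (k - l)"
  unfolding fourier_def L2_inner_def
  by (intro Bochner_Integration.integral_cong)
     (auto simp: cnj_character mult.assoc character_mult)

lemma fourier_bound: "f \<in> L2 torus_measure \<Longrightarrow> cmod (fourier f k) \<le> L2_norm torus_measure f"
  using L2_Cauchy_Schwarz[OF _ character_L2, of f k] by (simp add: fourier_def L2_norm_character)

definition trig_poly :: "(int \<times> int) set \<Rightarrow> (int \<times> int \<Rightarrow> complex) \<Rightarrow> complex \<times> complex \<Rightarrow> complex" where
  "trig_poly A c z = (\<Sum>k\<in>A. c k * character k z)"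

lemma trig_poly_L2: "trig_poly A c \<in> L2 torus_measure"
  unfolding trig_poly_def by (intro L2_sum L2_cmult character_L2)

lemma fourier_trig_poly: "finite A \<Longrightarrow> fourier (trig_poly A c) k = of_bool (k \<in> A) * c k"
  unfolding trig_poly_def
  by (subst fourier_sum)
     (auto intro!: L2_cmult character_L2 simp: fourier_cmult fourier_character of_bool_def sum.delta' if_distrib cong: if_cong)

lemma L2_inner_trig_poly:
  "f \<in> L2 torus_measure \<Longrightarrow> L2_inner torus_measure f (trig_poly A c) = (\<Sum>k\<in>A. fourier f k * cnj (c k))"
  unfolding trig_poly_def
  by (subst L2_inner_sum_right) (auto intro!: L2_cmult character_L2 simp: L2_inner_cmult_right fourier_def mult.commute)

lemma norm_trig_poly:
  assumes "finite A"
  shows "(L2_norm torus_measure (trig_poly A c))\<^sup>2 = (\<Sum>k\<in>A. (cmod (c k))\<^sup>2)"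
proof -
  have "complex_of_real ((L2_norm torus_measure (trig_poly A c))\<^sup>2) = (\<Sum>k\<in>A. c k * cnj (c k))"
    unfolding L2_norm_sq_inner L2_inner_trig_poly[OF trig_poly_L2]
    using assms by (simp add: fourier_trig_poly)
  also have "\<dots> = complex_of_real (\<Sum>k\<in>A. (cmod (c k))\<^sup>2)"
    by (simp only: complex_norm_square of_real_sum)
  finally show ?thesis
    by (simp only: of_real_eq_iff)
qed

text \<open>The term with \<open>c\<close> is nonnegative and vanishes for \<open>c = fourier f\<close>: among all trigonometric
  polynomials with frequencies in \<open>A\<close>, the partial Fourier sum is the best approximation.\<close>

lemma norm_trig_poly_diff:
  assumes "f \<in> L2 torus_measure" "finite A"
  shows "(L2_norm torus_measure (\<lambda>z. f z - trig_poly A c z))\<^sup>2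
    = (L2_norm torus_measure f)\<^sup>2 - (\<Sum>k\<in>A. (cmod (fourier f k))\<^sup>2) + (\<Sum>k\<in>A. (cmod (fourier f k - c k))\<^sup>2)"
proof -
  have "- 2 * Re (a * cnj b) + (cmod b)\<^sup>2 = - (cmod a)\<^sup>2 + (cmod (a - b))\<^sup>2" for a b
    unfolding cmod_power2 by (simp add: power2_eq_square algebra_simps)
  then have "(\<Sum>k\<in>A. - 2 * Re (fourier f k * cnj (c k)) + (cmod (c k))\<^sup>2)
      = (\<Sum>k\<in>A. - (cmod (fourier f k))\<^sup>2 + (cmod (fourier f k - c k))\<^sup>2)"
    by (intro sum.cong refl)
  then have "- 2 * (\<Sum>k\<in>A. Re (fourier f k * cnj (c k))) + (\<Sum>k\<in>A. (cmod (c k))\<^sup>2)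
      = - (\<Sum>k\<in>A. (cmod (fourier f k))\<^sup>2) + (\<Sum>k\<in>A. (cmod (fourier f k - c k))\<^sup>2)"
    by (simp only: sum.distrib sum_negf sum_distrib_left)
  then show ?thesis
    unfolding L2_norm_diff_sq[OF assms(1) trig_poly_L2] L2_inner_trig_poly[OF assms(1)] Re_sum
      norm_trig_poly[OF assms(2)]
    by linarith
qed

lemma Bessel:
  assumes "f \<in> L2 torus_measure" "finite A"
  shows "(\<Sum>k\<in>A. (cmod (fourier f k))\<^sup>2) \<le> (L2_norm torus_measure f)\<^sup>2"
  using norm_trig_poly_diff[OF assms, of "fourier f"]
    zero_le_power2[of "L2_norm torus_measure (\<lambda>z. f z - trig_poly A (fourier f) z)"] by simp

text \<open>The closed span of the characters with frequency in \<open>K\<close>. The Hardy space is the case of the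
  quadrant of nonnegative frequencies.\<close>

definition spectral :: "(int \<times> int) set \<Rightarrow> (complex \<times> complex \<Rightarrow> complex) set" where
  "spectral K = L2_closure torus_measure {trig_poly A c | A c. finite A \<and> A \<subseteq> K}"

lemma spectralI:
  assumes "f \<in> L2 torus_measure"
    and "\<And>e. e > 0 \<Longrightarrow> \<exists>A c. finite A \<and> A \<subseteq> K \<and> L2_norm torus_measure (\<lambda>z. f z - trig_poly A c z) < e"
  shows "f \<in> spectral K"
  using assms unfolding spectral_def L2_closure_def by blast

lemma spectral_L2: "f \<in> spectral K \<Longrightarrow> f \<in> L2 torus_measure"
  by (simp add: spectral_def L2_closure_def)

lemma spectral_mono: "K \<subseteq> K' \<Longrightarrow> f \<in> spectral K \<Longrightarrow> f \<in> spectral K'"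
  unfolding spectral_def L2_closure_def by blast

lemma spectral_approx:
  assumes "f \<in> spectral K" "e > 0"
  obtains A c where "finite A" "A \<subseteq> K" "L2_norm torus_measure (\<lambda>z. f z - trig_poly A c z) < e"
  using assms unfolding spectral_def L2_closure_def by blast

text \<open>A coefficient is bounded by the norm, and at \<open>k \<notin> K\<close> the approximating polynomials have
  coefficient \<open>0\<close>.\<close>

lemma fourier_spectral:
  assumes "f \<in> spectral K" "k \<notin> K"
  shows "fourier f k = 0"
proof -
  have "cmod (fourier f k) \<le> e" if "e > 0" for e
  proof -
    obtain A c where A: "finite A" "A \<subseteq> K" "L2_norm torus_measure (\<lambda>z. f z - trig_poly A c z) < e"
      using spectral_approx[OF assms(1) \<open>e > 0\<close>] .
    have "fourier f k = fourier (\<lambda>z. f z - trig_poly A c z) k"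
      using A assms by (auto simp: fourier_diff spectral_L2[OF assms(1)] trig_poly_L2 fourier_trig_poly)
    then show ?thesis
      using fourier_bound[OF L2_diff[OF spectral_L2[OF assms(1)] trig_poly_L2], of A c k] A(3) by simp
  qed
  then have "cmod (fourier f k) \<le> 0" by (rule field_le_epsilon[of _ 0, simplified])
  then show ?thesis by simp
qed

text \<open>Once the frequencies of one good approximation are included, best approximation makes every
  larger partial Fourier sum at least as good. So the partial sums converge along the net of
  finite sets, which is the form that \<open>has_sum\<close> asks for.\<close>

lemma spectral_partial_sums:
  assumes "f \<in> spectral K" "e > 0"
  obtains A where "finite A" "A \<subseteq> K"
    "\<And>B. finite B \<Longrightarrow> A \<subseteq> B \<Longrightarrow> L2_norm torus_measure (\<lambda>z. f z - trig_poly B (fourier f) z) < e"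
proof -
  obtain A c where A: "finite A" "A \<subseteq> K" "L2_norm torus_measure (\<lambda>z. f z - trig_poly A c z) < e"
    using spectral_approx[OF assms] .
  note f = spectral_L2[OF assms(1)]
  show ?thesis
  proof (rule that[OF A(1,2)])
    fix B :: "(int \<times> int) set" assume B: "finite B" "A \<subseteq> B"
    have "(L2_norm torus_measure (\<lambda>z. f z - trig_poly B (fourier f) z))\<^sup>2
        = (L2_norm torus_measure f)\<^sup>2 - (\<Sum>k\<in>B. (cmod (fourier f k))\<^sup>2)"
      using norm_trig_poly_diff[OF f B(1)] by simp
    also have "\<dots> \<le> (L2_norm torus_measure f)\<^sup>2 - (\<Sum>k\<in>A. (cmod (fourier f k))\<^sup>2)"
      by (intro diff_left_mono sum_mono2 B) auto
    also have "\<dots> \<le> (L2_norm torus_measure (\<lambda>z. f z - trig_poly A c z))\<^sup>2"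
      unfolding norm_trig_poly_diff[OF f A(1)] by (simp add: sum_nonneg)
    finally have "L2_norm torus_measure (\<lambda>z. f z - trig_poly B (fourier f) z)
        \<le> L2_norm torus_measure (\<lambda>z. f z - trig_poly A c z)"
      by (rule power2_le_imp_le) simp
    then show "L2_norm torus_measure (\<lambda>z. f z - trig_poly B (fourier f) z) < e"
      using A(3) by simp
  qed
qed

corollary spectral_partial_sum:
  assumes "f \<in> spectral K" "e > 0"
  obtains A where "finite A" "A \<subseteq> K" "L2_norm torus_measure (\<lambda>z. f z - trig_poly A (fourier f) z) < e"
  by (rule spectral_partial_sums[OF assms]) (blast intro: that)

text \<open>The partial Fourier sums approximate \<open>f\<close>, and their terms outside \<open>K'\<close> are zero.\<close>

lemma spectral_inter:
  assumes "f \<in> spectral K" "\<And>k. k \<notin> K' \<Longrightarrow> fourier f k = 0"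
  shows "f \<in> spectral (K \<inter> K')"
proof -
  have "\<exists>A c. finite A \<and> A \<subseteq> K \<inter> K' \<and> L2_norm torus_measure (\<lambda>z. f z - trig_poly A c z) < e"
    if "e > 0" for e
  proof -
    obtain A where A: "finite A" "A \<subseteq> K"
      "L2_norm torus_measure (\<lambda>z. f z - trig_poly A (fourier f) z) < e"
      using spectral_partial_sum[OF assms(1) \<open>e > 0\<close>] .
    have "trig_poly A (fourier f) = trig_poly (A \<inter> K') (fourier f)"
      unfolding trig_poly_def using assms(2) A(1)
      by (intro ext sum.mono_neutral_right) auto
    with A show ?thesis
      by (intro exI[of _ "A \<inter> K'"] exI[of _ "fourier f"]) auto
  qed
  with spectral_L2[OF assms(1)] show ?thesis
    unfolding spectral_def L2_closure_def by blast
qed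

text \<open>Uniqueness of Fourier coefficients: all partial sums vanish, and they approximate \<open>f\<close>.\<close>

lemma spectral_eq_zero:
  assumes "f \<in> spectral K" "\<And>k. k \<in> K \<Longrightarrow> fourier f k = 0"
  shows "AE z in torus_measure. f z = 0"
proof (rule L2_norm_zero_AE[OF spectral_L2[OF assms(1)]])
  have "L2_norm torus_measure f \<le> e" if e: "e > 0" for e
  proof -
    obtain A where "finite A" "A \<subseteq> K"
      "L2_norm torus_measure (\<lambda>z. f z - trig_poly A (fourier f) z) < e"
      using spectral_partial_sum[OF assms(1) e] .
    moreover from this have "trig_poly A (fourier f) = (\<lambda>z. 0)"
      unfolding trig_poly_def using assms(2) by (auto intro!: ext sum.neutral)
    ultimately show ?thesis by simp
  qed
  then have "L2_norm torus_measure f \<le> 0" by (rule field_le_epsilon[of _ 0, simplified])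
  then show "L2_norm torus_measure f = 0"
    using L2_norm_nonneg[of torus_measure f] by linarith
qed

text \<open>The partial sums on the left are the inner products of \<open>r\<close> with the partial Fourier sums of
  \<open>v\<close>. By the Cauchy-Schwarz inequality it suffices that the latter converge to \<open>v\<close>, so the
  approximability is asked of one factor only.\<close>

theorem Parseval:
  assumes "v \<in> spectral UNIV" "r \<in> L2 torus_measure"
  shows "((\<lambda>k. fourier r k * cnj (fourier v k)) has_sum L2_inner torus_measure r v) UNIV"
proof -
  note v = spectral_L2[OF assms(1)]
  have "\<forall>\<^sub>F B in finite_subsets_at_top UNIV.
      dist (\<Sum>k\<in>B. fourier r k * cnj (fourier v k)) (L2_inner torus_measure r v) < e" if "e > 0" for e
  proof -
    define d where "d = e / (L2_norm torus_measure r + 1)"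
    have pos: "L2_norm torus_measure r + 1 > 0" by (simp add: add_nonneg_pos)
    then have "d > 0" using \<open>e > 0\<close> by (simp add: d_def)
    then obtain A where A: "finite A"
      "\<And>B. finite B \<Longrightarrow> A \<subseteq> B \<Longrightarrow> L2_norm torus_measure (\<lambda>z. v z - trig_poly B (fourier v) z) < d"
      using spectral_partial_sums[OF assms(1)] by metis
    have "dist (\<Sum>k\<in>B. fourier r k * cnj (fourier v k)) (L2_inner torus_measure r v) < e"
      if B: "finite B" "A \<subseteq> B" for B
    proof -
      have "L2_inner torus_measure r v - (\<Sum>k\<in>B. fourier r k * cnj (fourier v k))
          = L2_inner torus_measure r (\<lambda>z. v z - trig_poly B (fourier v) z)"
        by (simp add: L2_inner_diff_right L2_inner_trig_poly assms(2) v trig_poly_L2)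
      also have "cmod \<dots> \<le> L2_norm torus_measure r * L2_norm torus_measure (\<lambda>z. v z - trig_poly B (fourier v) z)"
        by (intro L2_Cauchy_Schwarz L2_diff assms v trig_poly_L2)
      also have "\<dots> \<le> L2_norm torus_measure r * d"
        using A(2)[OF B] by (intro mult_left_mono) auto
      also have "\<dots> < (L2_norm torus_measure r + 1) * d"
        using \<open>d > 0\<close> by simp
      also have "\<dots> = e" using pos by (simp add: d_def)
      finally show ?thesis by (simp add: dist_norm norm_minus_commute)
    qed
    with A(1) show ?thesis
      unfolding eventually_finite_subsets_at_top by blast
  qed
  then show ?thesis
    unfolding has_sum_def tendsto_iff by blast
qed

section \<open>Closed spans of characters\<close>

lemma spectral_cong_AE:
  assumes f: "f \<in> spectral K" and ae: "AE z in torus_measure. f z = g z"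
    and [measurable]: "g \<in> borel_measurable torus_measure"
  shows "g \<in> spectral K"
proof -
  note L2 = spectral_L2[OF f]
  note [measurable] = L2_measurable[OF L2] L2_measurable[OF trig_poly_L2]
  have "AE z in torus_measure. (cmod (f z))\<^sup>2 = (cmod (g z))\<^sup>2"
    using ae by eventually_elim simp
  then have "integrable torus_measure (\<lambda>z. (cmod (g z))\<^sup>2)"
    by (rule integrable_cong_AE_imp[OF L2_sq_integrable[OF L2], rotated]) measurable
  then have "g \<in> L2 torus_measure" by (simp add: L2_def)
  moreover have "L2_norm torus_measure (\<lambda>z. g z - trig_poly A c z)
      = L2_norm torus_measure (\<lambda>z. f z - trig_poly A c z)" for A c
  proof -
    have "AE z in torus_measure. (cmod (g z - trig_poly A c z))\<^sup>2 = (cmod (f z - trig_poly A c z))\<^sup>2"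
      using ae by eventually_elim simp
    then show ?thesis
      unfolding L2_norm_def by (intro arg_cong[of _ _ sqrt] integral_cong_AE) measurable
  qed
  ultimately show ?thesis
    using spectral_approx[OF f] by (intro spectralI) (auto, metis)
qed

lemma spectral_cmult:
  assumes "f \<in> spectral K"
  shows "(\<lambda>z. c * f z) \<in> spectral K"
proof -
  have "\<exists>A d. finite A \<and> A \<subseteq> K \<and> L2_norm torus_measure (\<lambda>z. c * f z - trig_poly A d z) < e"
    if "e > 0" for e
  proof -
    have pos: "cmod c + 1 > 0" by (simp add: add_nonneg_pos)
    with \<open>e > 0\<close> have "e / (cmod c + 1) > 0" by simp
    then obtain A d where A: "finite A" "A \<subseteq> K"
      "L2_norm torus_measure (\<lambda>z. f z - trig_poly A d z) < e / (cmod c + 1)"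
      using spectral_approx[OF assms] by blast
    have "L2_norm torus_measure (\<lambda>z. c * f z - trig_poly A (\<lambda>k. c * d k) z)
        = L2_norm torus_measure (\<lambda>z. c * (f z - trig_poly A d z))"
      by (simp add: trig_poly_def sum_distrib_left algebra_simps)
    also have "\<dots> = cmod c * L2_norm torus_measure (\<lambda>z. f z - trig_poly A d z)"
      by (rule L2_norm_cmult)
    also have "\<dots> \<le> cmod c * (e / (cmod c + 1))"
      using A(3) by (intro mult_left_mono) auto
    also have "\<dots> < e"
      using \<open>e > 0\<close> pos by (simp add: field_simps)
    finally show ?thesis using A(1,2) by blast
  qed
  then show ?thesis by (intro spectralI L2_cmult[OF spectral_L2[OF assms]])
qed

lemma spectral_diff:
  assumes f: "f \<in> spectral K" and g: "g \<in> spectral K"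
  shows "(\<lambda>z. f z - g z) \<in> spectral K"
proof -
  note L2 = spectral_L2[OF f] spectral_L2[OF g]
  have "\<exists>A d. finite A \<and> A \<subseteq> K \<and> L2_norm torus_measure (\<lambda>z. (f z - g z) - trig_poly A d z) < e"
    if "e > 0" for e
  proof -
    from \<open>e > 0\<close> have e2: "e / 2 > 0" by simp
    obtain A where A: "finite A" "A \<subseteq> K"
      "\<And>C. finite C \<Longrightarrow> A \<subseteq> C \<Longrightarrow> L2_norm torus_measure (\<lambda>z. f z - trig_poly C (fourier f) z) < e / 2"
      using spectral_partial_sums[OF f e2] by metis
    obtain B where B: "finite B" "B \<subseteq> K"
      "\<And>C. finite C \<Longrightarrow> B \<subseteq> C \<Longrightarrow> L2_norm torus_measure (\<lambda>z. g z - trig_poly C (fourier g) z) < e / 2"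
      using spectral_partial_sums[OF g e2] by metis
    define C where "C = A \<union> B"
    have "L2_norm torus_measure (\<lambda>z. (f z - g z) - trig_poly C (\<lambda>k. fourier f k - fourier g k) z)
        = L2_norm torus_measure
            (\<lambda>z. (f z - trig_poly C (fourier f) z) - (g z - trig_poly C (fourier g) z))"
      by (simp add: trig_poly_def sum_subtractf algebra_simps)
    also have "\<dots> \<le> L2_norm torus_measure (\<lambda>z. f z - trig_poly C (fourier f) z)
        + L2_norm torus_measure (\<lambda>z. g z - trig_poly C (fourier g) z)"
      by (intro L2_norm_diff_triangle L2_diff L2 trig_poly_L2)
    also have "\<dots> < e"
      using A(3)[of C] B(3)[of C] A(1) B(1) by (simp add: C_def)
    finally show ?thesis using A(1,2) B(1,2) unfolding C_def by blast
  qed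
  then show ?thesis by (intro spectralI L2_diff L2)
qed

lemma spectral_add:
  assumes "f \<in> spectral K" "g \<in> spectral K"
  shows "(\<lambda>z. f z + g z) \<in> spectral K"
  using spectral_diff[OF assms(1) spectral_cmult[OF assms(2), of "-1"]] by simp

lemma trig_poly_spectral:
  assumes "finite A" "A \<subseteq> K"
  shows "trig_poly A c \<in> spectral K"
proof -
  have "L2_norm torus_measure (\<lambda>z. trig_poly A c z - trig_poly A c z) = 0"
    by (simp add: L2_norm_def)
  with assms show ?thesis by (intro spectralI trig_poly_L2 exI[of _ A] exI[of _ c]) simp
qed

lemma character_spectral: "k \<in> K \<Longrightarrow> character k \<in> spectral K"
  using trig_poly_spectral[of "{k}" K "\<lambda>_. 1"] by (simp add: trig_poly_def [abs_def])

text \<open>Conjugating a trigonometric polynomial negates its frequencies, but only on the torus: off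
  the torus \<open>cnj (character k z)\<close> and \<open>character (- k) z\<close> differ.\<close>

lemma spectral_cnj:
  assumes "f \<in> spectral K"
  shows "(\<lambda>z. cnj (f z)) \<in> spectral (uminus ` K)"
proof -
  have "\<exists>A d. finite A \<and> A \<subseteq> uminus ` K \<and> L2_norm torus_measure (\<lambda>z. cnj (f z) - trig_poly A d z) < e"
    if e: "e > 0" for e
  proof -
    obtain A c where A: "finite A" "A \<subseteq> K" "L2_norm torus_measure (\<lambda>z. f z - trig_poly A c z) < e"
      using spectral_approx[OF assms e] .
    have cnj_poly: "trig_poly (uminus ` A) (\<lambda>k. cnj (c (- k))) z = cnj (trig_poly A c z)"
      if "z \<in> space torus_measure" for z
      unfolding trig_poly_def using that
      by (subst sum.reindex) (auto simp: inj_on_def cnj_character)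
    have "L2_norm torus_measure (\<lambda>z. cnj (f z) - trig_poly (uminus ` A) (\<lambda>k. cnj (c (- k))) z)
        = L2_norm torus_measure (\<lambda>z. f z - trig_poly A c z)"
      unfolding L2_norm_def
      by (intro arg_cong[of _ _ sqrt] Bochner_Integration.integral_cong)
         (auto simp: cnj_poly simp flip: complex_cnj_diff)
    with A show ?thesis
      by (intro exI[of _ "uminus ` A"] exI[of _ "\<lambda>k. cnj (c (- k))"]) auto
  qed
  then show ?thesis by (intro spectralI L2_cnj[OF spectral_L2[OF assms]])
qed

text \<open>The partial Fourier sums over \<open>K\<close> intersected with growing squares form a Cauchy sequence,
  because their mutual distances are differences of the bounded increasing sequence of sums in
  Bessel's inequality. Completeness yields the limit, and each coefficient passes to it.\<close>

theorem Riesz_Fischer: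
  assumes "f \<in> L2 torus_measure"
  shows "\<exists>u\<in>spectral K. \<forall>k\<in>K. fourier u k = fourier f k"
proof -
  define A where "A n = K \<inter> ({- int n..int n} \<times> {- int n..int n})" for n
  define s where "s n = (\<Sum>k\<in>A n. (cmod (fourier f k))\<^sup>2)" for n
  define u where "u n = trig_poly (A n) (fourier f)" for n
  have fin: "finite (A n)" for n by (simp add: A_def)
  have A_mono: "A m \<subseteq> A n" if "m \<le> n" for m n
    using that by (auto simp: A_def)
  have u_L2: "u n \<in> L2 torus_measure" for n
    by (simp add: u_def trig_poly_L2)
  have "incseq s"
    unfolding incseq_def s_def by (intro allI impI sum_mono2 fin A_mono) auto
  moreover have "s n \<le> (L2_norm torus_measure f)\<^sup>2" for n
    unfolding s_def using Bessel[OF assms fin] .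
  ultimately obtain l where "s \<longlonglongrightarrow> l" using incseq_convergent[of s] by blast
  then have "Cauchy s" by (rule LIMSEQ_imp_Cauchy)
  have dist_u: "(L2_norm torus_measure (\<lambda>z. u m z - u n z))\<^sup>2 = \<bar>s m - s n\<bar>" for m n
  proof -
    have le: "(L2_norm torus_measure (\<lambda>z. u m z - u n z))\<^sup>2 = \<bar>s m - s n\<bar>" if "n \<le> m" for m n
    proof -
      have "u m z - u n z = trig_poly (A m - A n) (fourier f) z" for z
        unfolding u_def trig_poly_def using A_mono[OF that] fin by (simp add: sum_diff)
      moreover have "(\<Sum>k\<in>A m - A n. (cmod (fourier f k))\<^sup>2) = s m - s n"
        unfolding s_def using A_mono[OF that] fin by (simp add: sum_diff)
      moreover have "s n \<le> s m" using \<open>incseq s\<close> that by (auto simp: incseq_def)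
      ultimately show ?thesis by (simp add: norm_trig_poly fin)
    qed
    show ?thesis
    proof (cases "n \<le> m")
      case False
      then show ?thesis using le[of m n] by (simp add: L2_norm_def norm_minus_commute abs_minus_commute)
    qed (rule le)
  qed
  have "\<exists>N. \<forall>m\<ge>N. \<forall>n\<ge>N. L2_norm torus_measure (\<lambda>z. u m z - u n z) < e" if "e > 0" for e
  proof -
    obtain N where N: "\<And>m n. m \<ge> N \<Longrightarrow> n \<ge> N \<Longrightarrow> \<bar>s m - s n\<bar> < e\<^sup>2"
      using metric_CauchyD[OF \<open>Cauchy s\<close>, of "e\<^sup>2"] \<open>e > 0\<close> by (auto simp: dist_real_def)
    have "L2_norm torus_measure (\<lambda>z. u m z - u n z) < e" if "m \<ge> N" "n \<ge> N" for m n
      using N[OF that] \<open>e > 0\<close> by (intro power2_less_imp_less[of _ e]) (auto simp: dist_u)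
    then show ?thesis by blast
  qed
  then obtain v where v: "v \<in> L2 torus_measure" "(\<lambda>n. L2_norm torus_measure (\<lambda>x. v x - u n x)) \<longlonglongrightarrow> 0"
    using torus.L2_complete[of u] u_L2 by blast
  have "v \<in> spectral K"
  proof -
    have "\<exists>A c. finite A \<and> A \<subseteq> K \<and> L2_norm torus_measure (\<lambda>z. v z - trig_poly A c z) < e"
      if e: "e > 0" for e
    proof -
      obtain n where "L2_norm torus_measure (\<lambda>z. v z - u n z) < e"
        using order_tendstoD(2)[OF v(2) e] by (auto simp: eventually_sequentially)
      moreover have "A n \<subseteq> K" by (auto simp: A_def)
      ultimately show ?thesis unfolding u_def using fin[of n] by blast
    qed
    with v(1) show ?thesis by (rule spectralI)
  qed
  moreover have "fourier v k = fourier f k" if "k \<in> K" for k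
  proof -
    \<comment> \<open>from this index on the squares contain \<open>k\<close>\<close>
    define n0 where "n0 = nat (max \<bar>fst k\<bar> \<bar>snd k\<bar>)"
    have coeff: "fourier (u n) k = fourier f k" if "n \<ge> n0" for n
    proof -
      have "k \<in> A n" using \<open>k \<in> K\<close> that by (cases k) (auto simp: A_def n0_def)
      then show ?thesis by (simp add: u_def fourier_trig_poly fin)
    qed
    have "norm (fourier v k - fourier f k) \<le> L2_norm torus_measure (\<lambda>x. v x - u n x)" if "n \<ge> n0" for n
      using fourier_bound[OF L2_diff[OF v(1) u_L2], of n k] coeff[OF that]
      by (simp add: fourier_diff v(1) u_L2)
    then have "\<forall>\<^sub>F n in sequentially. norm (fourier v k - fourier f k) \<le> L2_norm torus_measure (\<lambda>x. v x - u n x)"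
      unfolding eventually_sequentially by blast
    then have "norm (fourier v k - fourier f k) \<le> 0"
      by (intro tendsto_lowerbound[OF v(2)]) auto
    then show ?thesis by simp
  qed
  ultimately show ?thesis by blast
qed

text \<open>The coefficient of \<open>g r\<close> at \<open>l\<close> is the inner product of \<open>r\<close> with \<open>v = cnj g * character l\<close>.
  This \<open>v\<close> is approximated by trigonometric polynomials since \<open>g\<close> is, so Parseval's formula
  applies.\<close>

theorem fourier_mult:
  assumes g: "g \<in> spectral UNIV" and r: "r \<in> L2 torus_measure"
  shows "((\<lambda>k. fourier g (l - k) * fourier r k) has_sum fourier (\<lambda>z. g z * r z) l) UNIV"
proof -
  define v where "v z = cnj (g z) * character l z" for z
  have inner: "L2_inner torus_measure r v = fourier (\<lambda>z. g z * r z) l"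
    unfolding fourier_def L2_inner_def v_def
    by (intro Bochner_Integration.integral_cong) (auto simp: mult_ac)
  have fourier_v: "fourier v k = cnj (fourier g (l - k))" for k
    unfolding v_def by (simp add: fourier_mult_character fourier_cnj)
  have v_spectral: "v \<in> spectral UNIV"
  proof (rule spectralI)
    have "(\<lambda>z. character l z * cnj (g z)) \<in> L2 torus_measure"
      by (intro L2_mult_Linf character_Linf L2_cnj spectral_L2[OF g])
    then show "v \<in> L2 torus_measure" by (simp add: v_def [abs_def] mult.commute)
    fix e :: real assume e: "e > 0"
    obtain A c where A: "finite A" "A \<subseteq> UNIV" "L2_norm torus_measure (\<lambda>z. g z - trig_poly A c z) < e"
      using spectral_approx[OF g e] .
    have "trig_poly ((\<lambda>k. l - k) ` A) (\<lambda>k. cnj (c (l - k))) z = cnj (trig_poly A c z) * character l z"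
      if z: "z \<in> space torus_measure" for z
    proof -
      have "trig_poly ((\<lambda>k. l - k) ` A) (\<lambda>k. cnj (c (l - k))) z = (\<Sum>k\<in>A. cnj (c k) * character (l - k) z)"
        unfolding trig_poly_def by (subst sum.reindex) (auto simp: inj_on_def)
      also have "\<dots> = (\<Sum>k\<in>A. cnj (c k) * (cnj (character k z) * character l z))"
        using z by (intro sum.cong refl) (simp add: cnj_character character_mult)
      finally show ?thesis by (simp add: trig_poly_def sum_distrib_right mult.assoc)
    qed
    then have "cmod (v z - trig_poly ((\<lambda>k. l - k) ` A) (\<lambda>k. cnj (c (l - k))) z) = cmod (g z - trig_poly A c z)"
      if "z \<in> space torus_measure" for z
      using norm_character[OF that, of l] that
      by (simp add: v_def norm_mult flip: left_diff_distrib complex_cnj_diff)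
    then have "L2_norm torus_measure (\<lambda>z. v z - trig_poly ((\<lambda>k. l - k) ` A) (\<lambda>k. cnj (c (l - k))) z)
        = L2_norm torus_measure (\<lambda>z. g z - trig_poly A c z)"
      unfolding L2_norm_def
      by (intro arg_cong[of _ _ sqrt] Bochner_Integration.integral_cong) auto
    with A show "\<exists>A c. finite A \<and> A \<subseteq> UNIV \<and> L2_norm torus_measure (\<lambda>z. v z - trig_poly A c z) < e"
      by (intro exI[of _ "(\<lambda>k. l - k) ` A"] exI[of _ "\<lambda>k. cnj (c (l - k))"]) simp
  qed
  show ?thesis
    using Parseval[OF v_spectral r] by (simp add: fourier_v inner mult.commute)
qed

section \<open>Functions of one variable\<close>

text \<open>Trigonometric polynomials converging to \<open>f\<close> in \<open>L\<^sup>2\<close>, hence in \<open>L\<^sup>1\<close>, have a subsequence that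
  converges almost everywhere.\<close>

lemma spectral_AE_limit:
  assumes f: "f \<in> spectral K"
  obtains p where "AE z in torus_measure. (\<lambda>n. p n z) \<longlonglongrightarrow> f z"
    "\<And>n. \<exists>A c. finite A \<and> A \<subseteq> K \<and> p n = trig_poly A c"
proof -
  have "\<exists>A c. finite A \<and> A \<subseteq> K \<and> L2_norm torus_measure (\<lambda>z. f z - trig_poly A c z) < inverse (real (Suc n))" for n
    using spectral_approx[OF f, of "inverse (real (Suc n))"] by (metis inverse_positive_iff_positive of_nat_0_less_iff zero_less_Suc)
  then obtain A c where A: "\<And>n. finite (A n)" "\<And>n. A n \<subseteq> K"
    "\<And>n. L2_norm torus_measure (\<lambda>z. f z - trig_poly (A n) (c n) z) < inverse (real (Suc n))"
    by metis
  define d where "d n z = f z - trig_poly (A n) (c n) z" for n z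
  have d_L2: "d n \<in> L2 torus_measure" for n
    unfolding d_def by (intro L2_diff spectral_L2[OF f] trig_poly_L2)
  have "(\<lambda>n. L2_norm torus_measure (d n)) \<longlonglongrightarrow> 0"
  proof (rule Lim_null_comparison[OF always_eventually[OF allI] LIMSEQ_inverse_real_of_nat])
    show "norm (L2_norm torus_measure (d n)) \<le> inverse (real (Suc n))" for n
      using A(3)[of n] by (simp add: d_def [abs_def])
  qed
  then have "(\<lambda>n. L2_norm torus_measure (d n) * L2_norm torus_measure (\<lambda>z. 1)) \<longlonglongrightarrow> 0"
    by (rule tendsto_mult_left_zero)
  then have "(\<lambda>n. LINT z|torus_measure. norm (d n z)) \<longlonglongrightarrow> 0"
    by (rule Lim_null_comparison[rotated]) (auto intro!: always_eventually torus.L1_le_L2 d_L2)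
  then obtain r where "AE z in torus_measure. (\<lambda>n. d (r n) z) \<longlonglongrightarrow> 0"
    using tendsto_L1_AE_subseq[of torus_measure d] torus.L2_integrable[OF d_L2] by blast
  then have "AE z in torus_measure. (\<lambda>n. trig_poly (A (r n)) (c (r n)) z) \<longlonglongrightarrow> f z"
  proof eventually_elim
    case (elim z)
    from tendsto_diff[OF tendsto_const[of "f z"] elim] show ?case by (simp add: d_def)
  qed
  then show ?thesis
    using A(1,2) by (intro that[of "\<lambda>n. trig_poly (A (r n)) (c (r n))"]) blast+
qed

text \<open>One direction is Fubini's theorem: the integral over the second variable is zero. Conversely,
  if only frequencies \<open>(m, 0)\<close> occur, then \<open>F\<close> is an almost everywhere limit of polynomials
  that do not depend on the second variable, and the function of \<open>z\<^sub>1\<close> is their pointwise limit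
  at the arbitrary value \<open>1\<close> of that variable.\<close>

lemma depends_only_on_z1_iff:
  assumes F: "F \<in> spectral UNIV"
  shows "depends_only_on_z1 F \<longleftrightarrow> (\<forall>k. snd k \<noteq> 0 \<longrightarrow> fourier F k = 0)"
proof
  assume "depends_only_on_z1 F"
  then obtain \<phi> where \<phi>: "\<phi> \<in> borel_measurable circle_measure" "AE z in torus_measure. F z = \<phi> (fst z)"
    by (auto simp: depends_only_on_z1_def)
  show "\<forall>k. snd k \<noteq> 0 \<longrightarrow> fourier F k = 0"
  proof (intro allI impI)
    fix k :: "int \<times> int" assume k: "snd k \<noteq> 0"
    have \<phi>_L2: "(\<lambda>z. \<phi> (fst z)) \<in> L2 torus_measure"
      using spectral_cong_AE[OF F \<phi>(2) torus_measurable_fst[OF \<phi>(1)]] by (rule spectral_L2)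
    have "fourier F k = fourier (\<lambda>z. \<phi> (fst z)) k"
      by (rule fourier_cong_AE[OF \<phi>(2) spectral_L2[OF F] torus_measurable_fst[OF \<phi>(1)]])
    also have "\<dots> = (LINT z|torus_measure. \<phi> (fst z) * cnj (character k z))"
      by (simp add: fourier_def L2_inner_def)
    also have "\<dots> = (LINT z|torus_measure. (\<phi> (fst z) * fst z powi (- fst k)) * snd z powi (- snd k))"
      by (intro Bochner_Integration.integral_cong) (auto simp: cnj_character, simp add: character_def mult.assoc)
    also have "\<dots> = (LINT x|circle_measure. \<phi> x * x powi (- fst k)) * (LINT y|circle_measure. y powi (- snd k))"
    proof (rule torus_integral_product)
      have "integrable torus_measure (\<lambda>z. \<phi> (fst z) * character (- k) z)"
        by (intro L2_mult_integrable \<phi>_L2 character_L2)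
      then show "integrable torus_measure (\<lambda>z. \<phi> (fst z) * fst z powi (- fst k) * snd z powi (- snd k))"
        by (simp add: character_def mult.assoc)
    qed
    also have "\<dots> = 0" using k by (simp add: circle_integral_powi)
    finally show "fourier F k = 0" .
  qed
next
  assume "\<forall>k. snd k \<noteq> 0 \<longrightarrow> fourier F k = 0"
  then have "F \<in> spectral (UNIV \<inter> {k. snd k = 0})"
    by (intro spectral_inter[OF F]) auto
  then obtain p where lim: "AE z in torus_measure. (\<lambda>n. p n z) \<longlonglongrightarrow> F z"
    and p: "\<And>n. \<exists>A c. finite A \<and> A \<subseteq> UNIV \<inter> {k. snd k = 0} \<and> p n = trig_poly A c"
    using spectral_AE_limit by blast
  have p_fst: "p n z = p n (fst z, 1)" for n z
  proof -
    obtain A c where A: "A \<subseteq> {k. snd k = 0}" "p n = trig_poly A c" using p[of n] by blast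
    have "character k z = character k (fst z, 1)" if "k \<in> A" for k
      using A(1) that by (auto simp: character_def)
    then show ?thesis unfolding A(2) trig_poly_def by simp
  qed
  have "(\<lambda>x. p n (x, 1)) \<in> borel_measurable circle_measure" for n
  proof -
    obtain A c where "p n = trig_poly A c" using p[of n] by blast
    then show ?thesis by (simp add: trig_poly_def character_def)
  qed
  then have "(\<lambda>x. lim (\<lambda>n. p n (x, 1))) \<in> borel_measurable circle_measure"
    by (rule borel_measurable_lim_metric)
  moreover have "AE z in torus_measure. F z = lim (\<lambda>n. p n (fst z, 1))"
    using lim
  proof eventually_elim
    case (elim z)
    then have "(\<lambda>n. p n (fst z, 1)) \<longlonglongrightarrow> F z" by (simp flip: p_fst)
    then show ?case by (rule limI[symmetric])
  qed
  ultimately show "depends_only_on_z1 F"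
    unfolding depends_only_on_z1_def by (intro bexI[where x = "\<lambda>x. lim (\<lambda>n. p n (x, 1))"])
qed

text \<open>The same argument with the two variables exchanged.\<close>

lemma depends_only_on_z2_iff:
  assumes F: "F \<in> spectral UNIV"
  shows "depends_only_on_z2 F \<longleftrightarrow> (\<forall>k. fst k \<noteq> 0 \<longrightarrow> fourier F k = 0)"
proof
  assume "depends_only_on_z2 F"
  then obtain \<phi> where \<phi>: "\<phi> \<in> borel_measurable circle_measure" "AE z in torus_measure. F z = \<phi> (snd z)"
    by (auto simp: depends_only_on_z2_def)
  show "\<forall>k. fst k \<noteq> 0 \<longrightarrow> fourier F k = 0"
  proof (intro allI impI)
    fix k :: "int \<times> int" assume k: "fst k \<noteq> 0"
    have \<phi>_L2: "(\<lambda>z. \<phi> (snd z)) \<in> L2 torus_measure"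
      using spectral_cong_AE[OF F \<phi>(2) torus_measurable_snd[OF \<phi>(1)]] by (rule spectral_L2)
    have "fourier F k = fourier (\<lambda>z. \<phi> (snd z)) k"
      by (rule fourier_cong_AE[OF \<phi>(2) spectral_L2[OF F] torus_measurable_snd[OF \<phi>(1)]])
    also have "\<dots> = (LINT z|torus_measure. \<phi> (snd z) * cnj (character k z))"
      by (simp add: fourier_def L2_inner_def)
    also have "\<dots> = (LINT z|torus_measure. fst z powi (- fst k) * (\<phi> (snd z) * snd z powi (- snd k)))"
      by (intro Bochner_Integration.integral_cong) (auto simp: cnj_character, simp add: character_def mult_ac)
    also have "\<dots> = (LINT x|circle_measure. x powi (- fst k)) * (LINT y|circle_measure. \<phi> y * y powi (- snd k))"
    proof (rule torus_integral_product)
      have "integrable torus_measure (\<lambda>z. \<phi> (snd z) * character (- k) z)"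
        by (intro L2_mult_integrable \<phi>_L2 character_L2)
      then show "integrable torus_measure (\<lambda>z. fst z powi (- fst k) * (\<phi> (snd z) * snd z powi (- snd k)))"
        by (simp add: character_def mult_ac)
    qed
    also have "\<dots> = 0" using k by (simp add: circle_integral_powi)
    finally show "fourier F k = 0" .
  qed
next
  assume "\<forall>k. fst k \<noteq> 0 \<longrightarrow> fourier F k = 0"
  then have "F \<in> spectral (UNIV \<inter> {k. fst k = 0})"
    by (intro spectral_inter[OF F]) auto
  then obtain p where lim: "AE z in torus_measure. (\<lambda>n. p n z) \<longlonglongrightarrow> F z"
    and p: "\<And>n. \<exists>A c. finite A \<and> A \<subseteq> UNIV \<inter> {k. fst k = 0} \<and> p n = trig_poly A c"
    using spectral_AE_limit by blast
  have p_snd: "p n z = p n (1, snd z)" for n z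
  proof -
    obtain A c where A: "A \<subseteq> {k. fst k = 0}" "p n = trig_poly A c" using p[of n] by blast
    have "character k z = character k (1, snd z)" if "k \<in> A" for k
      using A(1) that by (auto simp: character_def)
    then show ?thesis unfolding A(2) trig_poly_def by simp
  qed
  have "(\<lambda>y. p n (1, y)) \<in> borel_measurable circle_measure" for n
  proof -
    obtain A c where "p n = trig_poly A c" using p[of n] by blast
    then show ?thesis by (simp add: trig_poly_def character_def)
  qed
  then have "(\<lambda>y. lim (\<lambda>n. p n (1, y))) \<in> borel_measurable circle_measure"
    by (rule borel_measurable_lim_metric)
  moreover have "AE z in torus_measure. F z = lim (\<lambda>n. p n (1, snd z))"
    using lim
  proof eventually_elim
    case (elim z)
    then have "(\<lambda>n. p n (1, snd z)) \<longlonglongrightarrow> F z" by (simp flip: p_snd)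
    then show ?case by (rule limI[symmetric])
  qed
  ultimately show "depends_only_on_z2 F"
    unfolding depends_only_on_z2_def by (intro bexI[where x = "\<lambda>x. lim (\<lambda>n. p n (1, x))"])
qed

section \<open>The pluriharmonic Hardy space and its projections\<close>

definition pos_freqs :: "(int \<times> int) set" where
  "pos_freqs = {k. 0 \<le> fst k \<and> 0 \<le> snd k}"

definition plh_freqs :: "(int \<times> int) set" where
  "plh_freqs = pos_freqs \<union> uminus ` pos_freqs"

lemma mem_plh_freqs:
  "k \<in> plh_freqs \<longleftrightarrow> (0 \<le> fst k \<and> 0 \<le> snd k) \<or> (fst k \<le> 0 \<and> snd k \<le> 0)"
proof -
  have "k \<in> uminus ` pos_freqs \<longleftrightarrow> - k \<in> pos_freqs"
    by (metis add.inverse_inverse image_eqI imageE)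
  then show ?thesis by (auto simp: plh_freqs_def pos_freqs_def)
qed

text \<open>An equality of sets of functions on all of \<open>\<complex>\<^sup>2\<close>, since integer powers with nonnegative exponent
  are ordinary powers also at \<open>0\<close>. The coefficients of a trigonometric polynomial are extended
  by \<open>0\<close> to a square that contains its frequencies.\<close>

lemma analytic_polys_eq: "analytic_polys = {trig_poly A c | A c. finite A \<and> A \<subseteq> pos_freqs}"
proof (intro equalityI subsetI)
  fix p assume "p \<in> analytic_polys"
  then obtain N c where p: "p = (\<lambda>z. \<Sum>m\<le>N. \<Sum>n\<le>N. c m n * fst z ^ m * snd z ^ n)"
    by (auto simp: analytic_polys_def)
  have "p = trig_poly ({0..int N} \<times> {0..int N}) (\<lambda>k. c (nat (fst k)) (nat (snd k)))"
    unfolding p trig_poly_def sum.cartesian_product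
    by (intro ext sum.reindex_bij_witness[of _ "\<lambda>k. (nat (fst k), nat (snd k))" "\<lambda>k. (int (fst k), int (snd k))"])
       (auto simp: character_def mult.assoc)
  then show "p \<in> {trig_poly A c | A c. finite A \<and> A \<subseteq> pos_freqs}"
    by (fastforce simp: pos_freqs_def)
next
  fix p assume "p \<in> {trig_poly A c | A c. finite A \<and> A \<subseteq> pos_freqs}"
  then obtain A c where A: "finite A" "A \<subseteq> pos_freqs" and p: "p = trig_poly A c" by blast
  define N where "N = nat (Max ({0} \<union> fst ` A \<union> snd ` A))"
  have bound: "fst k \<le> int N \<and> snd k \<le> int N" if "k \<in> A" for k
  proof -
    have "fst k \<le> Max ({0} \<union> fst ` A \<union> snd ` A)" "snd k \<le> Max ({0} \<union> fst ` A \<union> snd ` A)"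
      using that A(1) by (auto intro!: Max_ge)
    then show ?thesis by (auto simp: N_def)
  qed
  define d where "d m n = (if (int m, int n) \<in> A then c (int m, int n) else 0)" for m n
  have "p z = (\<Sum>m\<le>N. \<Sum>n\<le>N. d m n * fst z ^ m * snd z ^ n)" for z
  proof -
    have "p z = (\<Sum>k\<in>A. d (nat (fst k)) (nat (snd k)) * fst z ^ nat (fst k) * snd z ^ nat (snd k))"
      unfolding p trig_poly_def
    proof (rule sum.cong[OF refl])
      fix k assume "k \<in> A"
      with A(2) have "0 \<le> fst k" "0 \<le> snd k" by (auto simp: pos_freqs_def)
      with \<open>k \<in> A\<close> show "c k * character k z
          = d (nat (fst k)) (nat (snd k)) * fst z ^ nat (fst k) * snd z ^ nat (snd k)"
        by (simp add: d_def character_def power_int_def mult.assoc)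
    qed
    also have "\<dots> = (\<Sum>k\<in>{k \<in> {..N} \<times> {..N}. (int (fst k), int (snd k)) \<in> A}.
        d (fst k) (snd k) * fst z ^ fst k * snd z ^ snd k)"
      by (rule sum.reindex_bij_witness[of _ "\<lambda>k. (int (fst k), int (snd k))" "\<lambda>k. (nat (fst k), nat (snd k))"])
         (use A(2) bound in \<open>auto simp: pos_freqs_def nat_le_iff subset_iff\<close>)
    also have "\<dots> = (\<Sum>k\<in>{..N} \<times> {..N}. d (fst k) (snd k) * fst z ^ fst k * snd z ^ snd k)"
      by (rule sum.mono_neutral_left) (auto simp: d_def)
    finally show ?thesis by (simp add: sum.cartesian_product split_def)
  qed
  then show "p \<in> analytic_polys" unfolding analytic_polys_def by blast
qed

lemma hardy2_eq_spectral: "hardy2 = spectral pos_freqs"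
  by (simp add: hardy2_def spectral_def analytic_polys_eq)

lemma plh_hardy2_spectral:
  assumes "f \<in> plh_hardy2"
  shows "f \<in> spectral plh_freqs"
proof -
  obtain u v where f: "f = (\<lambda>z. u z + cnj (v z))" and uv: "u \<in> spectral pos_freqs" "v \<in> spectral pos_freqs"
    using assms by (auto simp: plh_hardy2_def hardy2_eq_spectral)
  have "u \<in> spectral plh_freqs"
    using uv(1) by (rule spectral_mono[rotated]) (auto simp: plh_freqs_def)
  moreover have "(\<lambda>z. cnj (v z)) \<in> spectral plh_freqs"
    using spectral_cnj[OF uv(2)] by (rule spectral_mono[rotated]) (auto simp: plh_freqs_def)
  ultimately show ?thesis unfolding f by (rule spectral_add)
qed

lemma hardy2_subset_plh_hardy2: "hardy2 \<subseteq> plh_hardy2"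
proof
  fix f assume "f \<in> hardy2"
  moreover have "(\<lambda>z. 0) \<in> hardy2"
    using trig_poly_spectral[of "{}" pos_freqs] by (simp add: hardy2_eq_spectral trig_poly_def [abs_def])
  ultimately show "f \<in> plh_hardy2"
    unfolding plh_hardy2_def by (intro CollectI exI[of _ f] exI[of _ "\<lambda>z. 0"]) auto
qed

lemma character_hardy2: "k \<in> pos_freqs \<Longrightarrow> character k \<in> hardy2"
  by (simp add: hardy2_eq_spectral character_spectral)

lemma character_plh_hardy2:
  assumes "k \<in> plh_freqs"
  shows "\<exists>h\<in>plh_hardy2. \<forall>z\<in>space torus_measure. h z = character k z"
proof (cases "k \<in> pos_freqs")
  case True
  then have "character k \<in> plh_hardy2" using character_hardy2 hardy2_subset_plh_hardy2 by blast
  then show ?thesis by blast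
next
  case False
  with assms have "- k \<in> pos_freqs" by (auto simp: mem_plh_freqs pos_freqs_def)
  then have "(\<lambda>z. 0 + cnj (character (- k) z)) \<in> plh_hardy2"
    unfolding plh_hardy2_def
    using character_hardy2 trig_poly_spectral[of "{}" pos_freqs]
    by (intro CollectI exI[of _ "\<lambda>z. 0"] exI[of _ "character (- k)"])
       (auto simp: hardy2_eq_spectral trig_poly_def [abs_def])
  then show ?thesis by (rule rev_bexI) (simp add: cnj_character)
qed

text \<open>The pluriharmonic Hardy space is defined as a sum of two spaces, so a member with prescribed
  coefficients is assembled from two applications of the Riesz-Fischer theorem. The frequency
  \<open>0\<close>, common to both summands, is left to the analytic one.\<close>

lemma plh_hardy2_fourier_exists:
  assumes "f \<in> L2 torus_measure"
  shows "\<exists>u\<in>plh_hardy2. \<forall>k\<in>plh_freqs. fourier u k = fourier f k"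
proof -
  obtain u where u: "u \<in> spectral pos_freqs" "\<And>k. k \<in> pos_freqs \<Longrightarrow> fourier u k = fourier f k"
    using Riesz_Fischer[OF assms, of pos_freqs] by blast
  obtain v where v: "v \<in> spectral (pos_freqs - {0})"
      "\<And>k. k \<in> pos_freqs - {0} \<Longrightarrow> fourier v k = fourier (\<lambda>z. cnj (f z)) k"
    using Riesz_Fischer[OF L2_cnj[OF assms], of "pos_freqs - {0}"] by blast
  have "fourier (\<lambda>z. u z + cnj (v z)) k = fourier f k" if "k \<in> plh_freqs" for k
  proof -
    have sum: "fourier (\<lambda>z. u z + cnj (v z)) k = fourier u k + cnj (fourier v (- k))"
      using u(1) v(1) by (simp add: fourier_add L2_cnj spectral_L2 fourier_cnj)
    show ?thesis
    proof (cases "k \<in> pos_freqs")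
      case True
      then have "- k \<notin> pos_freqs - {0}"
        by (cases k) (auto simp: pos_freqs_def zero_prod_def)
      then show ?thesis using sum u(2)[OF True] fourier_spectral[OF v(1)] by simp
    next
      case False
      with that have "- k \<in> pos_freqs - {0}"
        by (cases k) (auto simp: mem_plh_freqs pos_freqs_def zero_prod_def)
      then show ?thesis using sum v(2) fourier_spectral[OF u(1) False] by (simp add: fourier_cnj)
    qed
  qed
  moreover have "(\<lambda>z. u z + cnj (v z)) \<in> plh_hardy2"
    using u(1) spectral_mono[OF _ v(1), of pos_freqs]
    unfolding plh_hardy2_def hardy2_eq_spectral by blast
  ultimately show ?thesis by blast
qed

text \<open>A function with the right coefficients differs from \<open>f\<close> by a function orthogonal to \<open>S\<close>, by
  Parseval's formula; so the choice in the definition of the projection is not vacuous. Testing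
  orthogonality on the characters in \<open>S\<close> determines the coefficients of whatever is chosen.
  Membership in \<open>S\<close> is kept separate from membership in \<open>spectral K\<close>, because the
  pluriharmonic Hardy space is given as a sum.\<close>

lemma L2_proj_fourier:
  assumes f: "f \<in> L2 torus_measure" and sub: "S \<subseteq> spectral K"
    and ex: "\<exists>u\<in>S. \<forall>k\<in>K. fourier u k = fourier f k"
    and char: "\<And>k. k \<in> K \<Longrightarrow> \<exists>h\<in>S. \<forall>z\<in>space torus_measure. h z = character k z"
  shows "L2_proj torus_measure S f \<in> S \<and> (\<forall>k\<in>K. fourier (L2_proj torus_measure S f) k = fourier f k)"
proof -
  define p where "p = L2_proj torus_measure S f"
  obtain u where u: "u \<in> S" "\<And>k. k \<in> K \<Longrightarrow> fourier u k = fourier f k" using ex by blast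
  have u_L2: "u \<in> L2 torus_measure" using u(1) sub spectral_L2 by blast
  have "L2_inner torus_measure (\<lambda>z. f z - u z) q = 0" if "q \<in> S" for q
  proof -
    have q: "q \<in> spectral K" using that sub by blast
    have "fourier (\<lambda>z. f z - u z) k * cnj (fourier q k) = 0" for k
      using u(2) fourier_spectral[OF q] f u_L2 by (cases "k \<in> K") (auto simp: fourier_diff)
    then have "((\<lambda>k. fourier (\<lambda>z. f z - u z) k * cnj (fourier q k)) has_sum 0) UNIV"
      by (intro has_sum_0)
    with Parseval[OF spectral_mono[OF subset_UNIV q] L2_diff[OF f u_L2]] show ?thesis
      by (rule has_sum_unique)
  qed
  with u(1) have "\<exists>p. p \<in> S \<and> (\<forall>q\<in>S. L2_inner torus_measure (\<lambda>x. f x - p x) q = 0)"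
    by blast
  then have "p \<in> S \<and> (\<forall>q\<in>S. L2_inner torus_measure (\<lambda>x. f x - p x) q = 0)"
    unfolding p_def L2_proj_def by (rule someI_ex)
  then have p: "p \<in> S" "\<And>q. q \<in> S \<Longrightarrow> L2_inner torus_measure (\<lambda>x. f x - p x) q = 0" by auto
  have p_L2: "p \<in> L2 torus_measure" using p(1) sub spectral_L2 by blast
  have "fourier p k = fourier f k" if k: "k \<in> K" for k
  proof -
    obtain h where h: "h \<in> S" "\<And>z. z \<in> space torus_measure \<Longrightarrow> h z = character k z"
      using char[OF k] by blast
    have "fourier (\<lambda>z. f z - p z) k = L2_inner torus_measure (\<lambda>z. f z - p z) h"
      unfolding fourier_def L2_inner_def by (intro Bochner_Integration.integral_cong) (auto simp: h(2))
    then show ?thesis using p(2)[OF h(1)] f p_L2 by (simp add: fourier_diff)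
  qed
  with p(1) show ?thesis unfolding p_def by blast
qed

lemma projP_fourier:
  assumes "f \<in> L2 torus_measure"
  shows "projP f \<in> hardy2" and "k \<in> pos_freqs \<Longrightarrow> fourier (projP f) k = fourier f k"
proof -
  have "projP f \<in> hardy2 \<and> (\<forall>k\<in>pos_freqs. fourier (projP f) k = fourier f k)"
    unfolding projP_def
  proof (rule L2_proj_fourier[OF assms])
    show "\<exists>u\<in>hardy2. \<forall>k\<in>pos_freqs. fourier u k = fourier f k"
      unfolding hardy2_eq_spectral by (rule Riesz_Fischer[OF assms])
    show "\<exists>h\<in>hardy2. \<forall>z\<in>space torus_measure. h z = character k z" if "k \<in> pos_freqs" for k
      using character_hardy2[OF that] by blast
  qed (simp add: hardy2_eq_spectral)
  then show "projP f \<in> hardy2" "k \<in> pos_freqs \<Longrightarrow> fourier (projP f) k = fourier f k" by auto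
qed

lemma projQ_fourier:
  assumes "f \<in> L2 torus_measure"
  shows "projQ f \<in> plh_hardy2" and "k \<in> plh_freqs \<Longrightarrow> fourier (projQ f) k = fourier f k"
proof -
  have "projQ f \<in> plh_hardy2 \<and> (\<forall>k\<in>plh_freqs. fourier (projQ f) k = fourier f k)"
    unfolding projQ_def
  proof (rule L2_proj_fourier[OF assms])
    show "plh_hardy2 \<subseteq> spectral plh_freqs" using plh_hardy2_spectral by blast
  qed (use plh_hardy2_fourier_exists[OF assms] character_plh_hardy2 in simp_all)
  then show "projQ f \<in> plh_hardy2" "k \<in> plh_freqs \<Longrightarrow> fourier (projQ f) k = fourier f k" by auto
qed

section \<open>Power series with proportional rows and columns\<close>

text \<open>Formal power series over a field have no zero divisors. The sum starts at \<open>j = 1\<close>, so the first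
  factor is \<open>u\<close> without its constant term.\<close>

lemma convolution_eq_zero:
  fixes u v :: "nat \<Rightarrow> complex"
  assumes "\<And>N. (\<Sum>j=1..N. u j * v (N - j)) = 0"
  shows "(\<forall>j\<ge>1. u j = 0) \<or> (\<forall>l. v l = 0)"
proof -
  define U where "U = Abs_fps (\<lambda>j. if j = 0 then 0 else u j)"
  have "U * Abs_fps v = 0"
  proof (rule fps_ext)
    fix N
    have "fps_nth (U * Abs_fps v) N = (\<Sum>j=0..N. (if j = 0 then 0 else u j) * v (N - j))"
      by (simp add: fps_mult_nth U_def)
    also have "\<dots> = (\<Sum>j=1..N. u j * v (N - j))"
      by (rule sum.mono_neutral_cong_right) auto
    finally show "fps_nth (U * Abs_fps v) N = fps_nth 0 N" using assms by simp
  qed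
  then have "U = 0 \<or> Abs_fps v = 0" by simp
  then show ?thesis
  proof
    assume "U = 0"
    moreover have "u j = fps_nth U j" if "j \<ge> 1" for j using that by (simp add: U_def)
    ultimately show ?thesis by simp
  next
    assume "Abs_fps v = 0"
    then have "fps_nth (Abs_fps v) l = 0" for l by simp
    then show ?thesis by simp
  qed
qed

text \<open>Read \<open>u i j = (F i j, G i j)\<close> as a table of vectors and \<open>F i m * G i' n - G i m * F i' n\<close> as
  determinants. Suppose that some \<open>u i j\<close> with \<open>i \<ge> 1\<close> and some \<open>u i j\<close> with \<open>j \<ge> 1\<close> are nonzero;
  let \<open>b\<close> and \<open>a\<close> be the least first indices for which this happens. Then the equation \<open>rows\<close> for
  \<open>N = a + b\<close> has a single nonzero term and puts all \<open>u b m\<close>, and all \<open>u a n\<close> with \<open>n \<ge> 1\<close>, on one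
  line \<open>L = 0\<close>. With this, the equations \<open>cols\<close> turn into products of power series, one factor of
  which is nonzero; cancelling it, first with \<open>n = b\<close> and then with \<open>m = a\<close>, shows \<open>L = 0\<close>
  at every index other than
  \<open>(0, 0)\<close>.\<close>

lemma analytic_trichotomy:
  fixes F G :: "nat \<Rightarrow> nat \<Rightarrow> complex"
  assumes rows: "\<And>m n N. n \<ge> 1 \<Longrightarrow> (\<Sum>i=1..N. F i m * G (N - i) n - G i m * F (N - i) n) = 0"
    and cols: "\<And>m n N. n \<ge> 1 \<Longrightarrow> (\<Sum>j=1..N. F m j * G n (N - j) - G m j * F n (N - j)) = 0"
  shows "(\<exists>\<alpha> \<beta>. \<not> (\<alpha> = 0 \<and> \<beta> = 0) \<and> (\<forall>i j. (i, j) \<noteq> (0, 0) \<longrightarrow> \<alpha> * F i j + \<beta> * G i j = 0))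
    \<or> (\<forall>i j. i \<ge> 1 \<longrightarrow> F i j = 0 \<and> G i j = 0) \<or> (\<forall>i j. j \<ge> 1 \<longrightarrow> F i j = 0 \<and> G i j = 0)"
proof (rule disjCI)
  assume "\<not> ((\<forall>i j. i \<ge> 1 \<longrightarrow> F i j = 0 \<and> G i j = 0) \<or> (\<forall>i j. j \<ge> 1 \<longrightarrow> F i j = 0 \<and> G i j = 0))"
  then have ex1: "\<exists>i. i \<ge> 1 \<and> (\<exists>m. \<not> (F i m = 0 \<and> G i m = 0))"
    and ex2: "\<exists>i. \<exists>n\<ge>1. \<not> (F i n = 0 \<and> G i n = 0)" by auto
  define b where "b = (LEAST i. i \<ge> 1 \<and> (\<exists>m. \<not> (F i m = 0 \<and> G i m = 0)))"
  define a where "a = (LEAST i. \<exists>n\<ge>1. \<not> (F i n = 0 \<and> G i n = 0))"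
  obtain m0 where b: "b \<ge> 1" "\<not> (F b m0 = 0 \<and> G b m0 = 0)"
    using LeastI_ex[OF ex1] unfolding b_def[symmetric] by blast
  obtain n0 where a: "n0 \<ge> 1" "\<not> (F a n0 = 0 \<and> G a n0 = 0)"
    using LeastI_ex[OF ex2] unfolding a_def[symmetric] by blast
  have below_b: "F i m = 0 \<and> G i m = 0" if "1 \<le> i" "i < b" for i m
    using not_less_Least[of i "\<lambda>i. i \<ge> 1 \<and> (\<exists>m. \<not> (F i m = 0 \<and> G i m = 0))"] that
    unfolding b_def[symmetric] by blast
  have below_a: "F i n = 0 \<and> G i n = 0" if "i < a" "1 \<le> n" for i n
    using not_less_Least[of i "\<lambda>i. \<exists>n\<ge>1. \<not> (F i n = 0 \<and> G i n = 0)"] that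
    unfolding a_def[symmetric] by blast
  have corner: "F b m * G a n = G b m * F a n" if "n \<ge> 1" for m n
  proof -
    have "(\<Sum>i=1..a+b. F i m * G (a + b - i) n - G i m * F (a + b - i) n)
        = (\<Sum>i\<in>{b}. F i m * G (a + b - i) n - G i m * F (a + b - i) n)"
    proof (rule sum.mono_neutral_right)
      show "\<forall>i\<in>{1..a + b} - {b}. F i m * G (a + b - i) n - G i m * F (a + b - i) n = 0"
      proof
        fix i assume i: "i \<in> {1..a + b} - {b}"
        show "F i m * G (a + b - i) n - G i m * F (a + b - i) n = 0"
        proof (cases "i < b")
          case True
          then show ?thesis using below_b[of i m] i by simp
        next
          case False
          then have "a + b - i < a" using i by auto
          then show ?thesis using below_a[of "a + b - i" n] that by simp
        qed
      qed
    qed (use b in auto)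
    then show ?thesis using rows[OF that, where m = m and N = "a + b"] by simp
  qed
  \<comment> \<open>the linear form that vanishes on the vector \<open>u b m0\<close>\<close>
  define \<alpha> where "\<alpha> = G b m0"
  define \<beta> where "\<beta> = - F b m0"
  have nz: "\<not> (\<alpha> = 0 \<and> \<beta> = 0)" using b(2) by (auto simp: \<alpha>_def \<beta>_def)
  define L where "L i j = \<alpha> * F i j + \<beta> * G i j" for i j
  have La: "L a n = 0" if "n \<ge> 1" for n
    using corner[OF that, of m0] by (simp add: L_def \<alpha>_def \<beta>_def)
  have Lb: "L b m = 0" for m
  proof -
    have "G a n0 * L b m = 0" "F a n0 * L b m = 0"
      using La[OF a(1)] corner[OF a(1), of m] unfolding L_def by algebra+
    then show ?thesis using a(2) by auto
  qed
  have L_cols: "L m j = 0" if "j \<ge> 1" for m j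
  proof -
    have "(\<Sum>j=1..N. L m j * G b (N - j)) = 0" for N
    proof -
      have "(\<Sum>j=1..N. L m j * G b (N - j)) = (\<Sum>j=1..N. \<alpha> * (F m j * G b (N - j) - G m j * F b (N - j)))"
      proof (rule sum.cong[OF refl])
        fix j show "L m j * G b (N - j) = \<alpha> * (F m j * G b (N - j) - G m j * F b (N - j))"
          using Lb[of "N - j"] unfolding L_def by algebra
      qed
      also have "\<dots> = 0" using cols[OF b(1), where m = m and N = N] by (simp add: sum_distrib_left[symmetric])
      finally show ?thesis .
    qed
    moreover have "(\<Sum>j=1..N. L m j * F b (N - j)) = 0" for N
    proof -
      have "(\<Sum>j=1..N. L m j * F b (N - j)) = (\<Sum>j=1..N. - \<beta> * (F m j * G b (N - j) - G m j * F b (N - j)))"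
      proof (rule sum.cong[OF refl])
        fix j show "L m j * F b (N - j) = - \<beta> * (F m j * G b (N - j) - G m j * F b (N - j))"
          using Lb[of "N - j"] unfolding L_def by algebra
      qed
      also have "\<dots> = 0" using cols[OF b(1), where m = m and N = N] by (simp only: sum_distrib_left[symmetric] mult_zero_right)
      finally show ?thesis .
    qed
    ultimately show ?thesis
      using convolution_eq_zero[of "L m" "G b"] convolution_eq_zero[of "L m" "F b"] b(2) that by metis
  qed
  have L_rows: "L n l = 0" if "n \<ge> 1" for n l
  proof -
    have "(\<Sum>j=1..N. G a j * L n (N - j)) = 0" for N
    proof -
      have "(\<Sum>j=1..N. G a j * L n (N - j)) = (\<Sum>j=1..N. - \<alpha> * (F a j * G n (N - j) - G a j * F n (N - j)))"
      proof (rule sum.cong[OF refl])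
        fix j assume "j \<in> {1..N}"
        then show "G a j * L n (N - j) = - \<alpha> * (F a j * G n (N - j) - G a j * F n (N - j))"
          using La[of j] unfolding L_def by simp algebra
      qed
      also have "\<dots> = 0" using cols[OF that, where m = a and N = N] by (simp only: sum_distrib_left[symmetric] mult_zero_right)
      finally show ?thesis .
    qed
    moreover have "(\<Sum>j=1..N. F a j * L n (N - j)) = 0" for N
    proof -
      have "(\<Sum>j=1..N. F a j * L n (N - j)) = (\<Sum>j=1..N. \<beta> * (F a j * G n (N - j) - G a j * F n (N - j)))"
      proof (rule sum.cong[OF refl])
        fix j assume "j \<in> {1..N}"
        then show "F a j * L n (N - j) = \<beta> * (F a j * G n (N - j) - G a j * F n (N - j))"
          using La[of j] unfolding L_def by simp algebra
      qed
      also have "\<dots> = 0" using cols[OF that, where m = a and N = N] by (simp add: sum_distrib_left[symmetric])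
      finally show ?thesis .
    qed
    ultimately show ?thesis
      using convolution_eq_zero[of "G a" "L n"] convolution_eq_zero[of "F a" "L n"] a by metis
  qed
  have "L i j = 0" if "(i, j) \<noteq> (0, 0)" for i j
    using L_cols[of j i] L_rows[of i j] that by (cases "i \<ge> 1") auto
  then show "\<exists>\<alpha> \<beta>. \<not> (\<alpha> = 0 \<and> \<beta> = 0) \<and> (\<forall>i j. (i, j) \<noteq> (0, 0) \<longrightarrow> \<alpha> * F i j + \<beta> * G i j = 0)"
    using nz unfolding L_def by blast
qed

section \<open>Sums over opposite quadrants\<close>

lemma has_sum_diff:
  fixes f g :: "'a \<Rightarrow> 'b :: topological_ab_group_add"
  assumes "(f has_sum a) A" "(g has_sum b) A"
  shows "((\<lambda>x. f x - g x) has_sum (a - b)) A"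
proof -
  have "((\<lambda>x. - g x) has_sum - b) A" using assms(2) by (simp add: has_sum_uminus)
  from has_sum_add[OF assms(1) this] show ?thesis by simp
qed

text \<open>The mixed second difference of the hypothesis in \<open>s\<close> and \<open>t\<close> involves only two points and gives
  \<open>\<gamma> (s + 1) t = - \<gamma> s (t + 1)\<close>. For \<open>t = 0\<close> the first difference in \<open>s\<close> says that each
  column sums to zero over \<open>y > 0\<close>. By the antidiagonal relation the tail of column \<open>x + 1\<close>
  beyond \<open>t\<close> is, up to sign, the tail of column \<open>x\<close> beyond \<open>t + 1\<close>; so by induction all tails of
  all columns vanish, and consecutive tails differ by one entry.\<close>

lemma opposite_quadrant_sums_column:
  fixes \<gamma> :: "nat \<Rightarrow> nat \<Rightarrow> complex"
  assumes sums: "\<And>s t. ((\<lambda>(x, y). \<gamma> x y) has_sum 0) {(x, y). x < s \<and> t < y \<or> s < x \<and> y < t}"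
  shows "\<gamma> x (Suc y) = 0"
proof -
  define c where "c s t = (\<lambda>p. of_bool (fst p < s \<and> t < snd p \<or> s < fst p \<and> snd p < t) * (case p of (x, y) \<Rightarrow> \<gamma> x y))" for s t
  have c: "(c s t has_sum 0) UNIV" for s t
    using has_sum_cong_neutral[THEN iffD1, OF _ _ _ sums[of s t], of UNIV "c s t"]
    by (auto simp: c_def split: prod.splits)
  have rec: "\<gamma> s (Suc t) + \<gamma> (Suc s) t = 0" for s t
  proof -
    have "((\<lambda>p. (c (Suc s) t p - c s t p) - (c (Suc s) (Suc t) p - c s (Suc t) p)) has_sum 0 - 0 - (0 - 0)) UNIV"
      by (intro has_sum_diff c)
    moreover have "(c (Suc s) t p - c s t p) - (c (Suc s) (Suc t) p - c s (Suc t) p)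
        = of_bool (p \<in> {(s, Suc t), (Suc s, t)}) * (case p of (x, y) \<Rightarrow> \<gamma> x y)" for p
      by (cases p) (auto simp: c_def)
    ultimately have "((\<lambda>p. of_bool (p \<in> {(s, Suc t), (Suc s, t)}) * (case p of (x, y) \<Rightarrow> \<gamma> x y)) has_sum 0) UNIV"
      by simp
    then have "((\<lambda>p. case p of (x, y) \<Rightarrow> \<gamma> x y) has_sum 0) {(s, Suc t), (Suc s, t)}"
      by (rule has_sum_cong_neutral[THEN iffD1, rotated 3]) auto
    moreover have "((\<lambda>p. case p of (x, y) \<Rightarrow> \<gamma> x y) has_sum (\<gamma> s (Suc t) + \<gamma> (Suc s) t)) {(s, Suc t), (Suc s, t)}"
      by (rule has_sum_finiteI) auto
    ultimately show ?thesis by (metis has_sum_unique)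
  qed
  have tail: "(\<gamma> x has_sum 0) {t<..}" for x t
  proof (induction t arbitrary: x)
    case 0
    have "((\<lambda>p. c (Suc x) 0 p - c x 0 p) has_sum 0) UNIV"
      using has_sum_diff[OF c[of "Suc x" 0] c[of x 0]] by simp
    then have "((\<lambda>p. case p of (x, y) \<Rightarrow> \<gamma> x y) has_sum 0) (Pair x ` {0<..})"
      by (rule has_sum_cong_neutral[THEN iffD1, rotated 3]) (auto simp: c_def)
    then show ?case
      by (subst (asm) has_sum_reindex) (auto simp: inj_on_def o_def)
  next
    case (Suc t)
    have "\<gamma> (Suc x) y = - \<gamma> x (Suc y)" for y
      using rec[of x y] by (simp add: add_eq_0_iff)
    then have "((\<lambda>y. - \<gamma> x (Suc y)) has_sum 0) {t<..}"
      using Suc.IH[of "Suc x"] by simp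
    then have "((\<lambda>y. \<gamma> x (Suc y)) has_sum 0) {t<..}"
      by (subst (asm) has_sum_uminus) simp
    then have "(\<gamma> x has_sum 0) (Suc ` {t<..})"
      by (subst has_sum_reindex) (auto simp: o_def)
    moreover have "Suc ` {t<..} = {Suc t<..}"
    proof (intro equalityI subsetI)
      fix y assume "y \<in> {Suc t<..}"
      then show "y \<in> Suc ` {t<..}" by (cases y) auto
    qed auto
    ultimately show ?case by simp
  qed
  have "(\<gamma> x has_sum 0 - 0) ({y<..} - {Suc y<..})"
    by (rule has_sum_Diff[OF tail tail]) auto
  moreover have "{y<..} - {Suc y<..} = {Suc y}" by auto
  moreover have "(\<gamma> x has_sum \<gamma> x (Suc y)) {Suc y}"
    by (rule has_sum_finiteI) auto
  ultimately show ?thesis by (metis diff_zero has_sum_unique)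
qed

text \<open>An index other than \<open>(0, 0)\<close> has a positive coordinate. The hypothesis is symmetric in the two
  coordinates, so the previous lemma covers both cases.\<close>

lemma opposite_quadrant_sums:
  fixes \<gamma> :: "nat \<Rightarrow> nat \<Rightarrow> complex"
  assumes sums: "\<And>s t. ((\<lambda>(x, y). \<gamma> x y) has_sum 0) {(x, y). x < s \<and> t < y \<or> s < x \<and> y < t}"
    and "(x, y) \<noteq> (0, 0)"
  shows "\<gamma> x y = 0"
proof -
  have "((\<lambda>(x, y). \<gamma> y x) has_sum 0) {(x, y). x < s \<and> t < y \<or> s < x \<and> y < t}" for s t
  proof -
    have "prod.swap ` {(x, y). x < s \<and> t < y \<or> s < x \<and> y < t} = {(x, y). x < t \<and> s < y \<or> t < x \<and> y < s}"
      by (auto simp: image_iff prod.swap_def)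
    with sums[of t s] have "((\<lambda>(x, y). \<gamma> x y) has_sum 0) (prod.swap ` {(x, y). x < s \<and> t < y \<or> s < x \<and> y < t})"
      by simp
    then show ?thesis
      by (subst (asm) has_sum_reindex) (auto simp: o_def case_prod_unfold inj_on_def prod_eq_iff)
  qed
  from opposite_quadrant_sums_column[OF this, of y] have "\<gamma> (Suc x) y = 0" for x y
    using opposite_quadrant_sums_column[of "\<lambda>x y. \<gamma> y x"]
      \<open>\<And>s t. ((\<lambda>(x, y). \<gamma> y x) has_sum 0) {(x, y). x < s \<and> t < y \<or> s < x \<and> y < t}\<close> by blast
  moreover have "\<gamma> x (Suc y) = 0" for x y
    by (rule opposite_quadrant_sums_column[OF sums])
  ultimately show ?thesis using assms(2) by (cases x; cases y) auto
qed

section \<open>Coefficient sequences of commuting symbols\<close>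

text \<open>What commutation of two Toeplitz operators says on characters. In this form it is visibly
  invariant under exchange of the coordinates and under reflection at the origin.\<close>

definition commuting_coeffs :: "(int \<times> int \<Rightarrow> complex) \<Rightarrow> (int \<times> int \<Rightarrow> complex) \<Rightarrow> bool" where
  "commuting_coeffs F G \<longleftrightarrow>
     (\<forall>k. k \<notin> plh_freqs \<longrightarrow> F k = 0 \<and> G k = 0) \<and>
     (\<forall>j\<in>plh_freqs. \<forall>k\<in>plh_freqs.
        ((\<lambda>l. F (j - l) * G (l - k) - G (j - l) * F (l - k)) has_sum 0) (- plh_freqs))"

lemma commuting_coeffs_zero: "commuting_coeffs F G \<Longrightarrow> k \<notin> plh_freqs \<Longrightarrow> F k = 0 \<and> G k = 0"
  and commuting_coeffs_sum: "commuting_coeffs F G \<Longrightarrow> j \<in> plh_freqs \<Longrightarrow> k \<in> plh_freqs \<Longrightarrow>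
    ((\<lambda>l. F (j - l) * G (l - k) - G (j - l) * F (l - k)) has_sum 0) (- plh_freqs)"
  unfolding commuting_coeffs_def by blast+

lemma commuting_coeffs_swap:
  assumes "commuting_coeffs F G"
  shows "commuting_coeffs (\<lambda>k. F (prod.swap k)) (\<lambda>k. G (prod.swap k))"
proof -
  have mem: "prod.swap k \<in> plh_freqs \<longleftrightarrow> k \<in> plh_freqs" for k
    by (auto simp: mem_plh_freqs)
  have swap_diff: "prod.swap (a - b) = prod.swap a - prod.swap b" for a b :: "int \<times> int"
    by (simp add: prod_eq_iff)
  have "((\<lambda>l. F (prod.swap (j - l)) * G (prod.swap (l - k)) - G (prod.swap (j - l)) * F (prod.swap (l - k)))
      has_sum 0) (- plh_freqs)" if "j \<in> plh_freqs" "k \<in> plh_freqs" for j k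
    using commuting_coeffs_sum[OF assms mem[THEN iffD2, OF that(1)] mem[THEN iffD2, OF that(2)]]
    by (subst (asm) has_sum_reindex_bij_witness[of _ prod.swap prod.swap, symmetric]) (auto simp: mem swap_diff)
  then show ?thesis
    using commuting_coeffs_zero[OF assms] by (auto simp: commuting_coeffs_def mem)
qed

lemma commuting_coeffs_uminus:
  assumes "commuting_coeffs F G"
  shows "commuting_coeffs (\<lambda>k. F (- k)) (\<lambda>k. G (- k))"
proof -
  have mem: "- k \<in> plh_freqs \<longleftrightarrow> k \<in> plh_freqs" for k
    by (auto simp: mem_plh_freqs)
  have "((\<lambda>l. F (- (j - l)) * G (- (l - k)) - G (- (j - l)) * F (- (l - k)))
      has_sum 0) (- plh_freqs)" if "j \<in> plh_freqs" "k \<in> plh_freqs" for j k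
    using commuting_coeffs_sum[OF assms mem[THEN iffD2, OF that(1)] mem[THEN iffD2, OF that(2)]]
    by (subst (asm) has_sum_reindex_bij_witness[of _ uminus uminus, symmetric]) (auto simp: mem)
  then show ?thesis
    using commuting_coeffs_zero[OF assms] by (auto simp: commuting_coeffs_def mem)
qed

text \<open>Take \<open>j = (0, t)\<close> and \<open>k = (- N, t - (m + n))\<close> with \<open>t \<le> m + n\<close>. The nonzero terms of the
  equation are those with \<open>p = j - l\<close> in the rectangle \<open>1 \<le> fst p \<le> N\<close>, \<open>0 \<le> snd p < t\<close>.
  Subtracting the equation for \<open>t = m\<close> from the one for \<open>t = m + 1\<close> isolates one row; this needs
  \<open>m + 1 \<le> m + n\<close>, whence \<open>n \<ge> 1\<close>.\<close>

lemma commuting_coeffs_rows: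
  fixes m n N :: nat
  assumes comm: "commuting_coeffs F G" and "n \<ge> 1"
  shows "(\<Sum>i=1..N. F (int i, int m) * G (int (N - i), int n) - G (int i, int m) * F (int (N - i), int n)) = 0"
proof -
  define B where "B i s = F (int i, int s) * G (int (N - i), int (m + n - s))
      - G (int i, int s) * F (int (N - i), int (m + n - s))" for i s
  have rectangle: "(\<Sum>i=1..N. \<Sum>s<t. B i s) = 0" if t: "t \<le> m + n" for t
  proof -
    define j where "j = (0 :: int, int t)"
    define k where "k = (- int N, int t - int (m + n))"
    define c where "c l = F (j - l) * G (l - k) - G (j - l) * F (l - k)" for l
    define \<phi> where "\<phi> = (\<lambda>(i, s). (- int i, int t - int s))"
    have c0: "c l = 0" if "j - l \<notin> plh_freqs \<or> l - k \<notin> plh_freqs" for l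
      using commuting_coeffs_zero[OF comm, of "j - l"] commuting_coeffs_zero[OF comm, of "l - k"] that
      by (auto simp: c_def)
    have "j \<in> plh_freqs" "k \<in> plh_freqs"
      using t by (auto simp: j_def k_def mem_plh_freqs)
    then have "(c has_sum 0) (- plh_freqs)"
      unfolding c_def by (rule commuting_coeffs_sum[OF comm])
    moreover have "c l = 0" if l: "l \<in> - plh_freqs - \<phi> ` ({1..N} \<times> {..<t})" for l
    proof (rule ccontr)
      assume "c l \<noteq> 0"
      then have mem: "j - l \<in> plh_freqs" "l - k \<in> plh_freqs" using c0 by blast+
      obtain x y where xy: "l = (x, y)" by (cases l)
      have "(0 < x \<and> y < 0) \<or> (x < 0 \<and> 0 < y)"
        using l by (auto simp: xy mem_plh_freqs not_le)
      then have *: "x < 0" "0 < y" "y \<le> int t" "- int N \<le> x"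
        using mem t by (auto simp: xy j_def k_def mem_plh_freqs)
      then have "l = \<phi> (nat (- x), nat (int t - y))" "(nat (- x), nat (int t - y)) \<in> {1..N} \<times> {..<t}"
        by (auto simp: xy \<phi>_def)
      with l show False by blast
    qed
    moreover have sub: "\<phi> ` ({1..N} \<times> {..<t}) \<subseteq> - plh_freqs"
      by (auto simp: \<phi>_def mem_plh_freqs)
    ultimately have "(c has_sum 0) (\<phi> ` ({1..N} \<times> {..<t}))"
      by (subst has_sum_cong_neutral[of "- plh_freqs" _ c c]) auto
    moreover have "(c has_sum sum c (\<phi> ` ({1..N} \<times> {..<t}))) (\<phi> ` ({1..N} \<times> {..<t}))"
      by (rule has_sum_finite) simp
    ultimately have "sum c (\<phi> ` ({1..N} \<times> {..<t})) = 0"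
      by (rule has_sum_unique[rotated])
    moreover have "inj_on \<phi> ({1..N} \<times> {..<t})"
      by (auto simp: \<phi>_def inj_on_def)
    ultimately have "(\<Sum>p\<in>{1..N} \<times> {..<t}. c (\<phi> p)) = 0"
      by (simp add: sum.reindex)
    also have "(\<Sum>p\<in>{1..N} \<times> {..<t}. c (\<phi> p)) = (\<Sum>(i, s)\<in>{1..N} \<times> {..<t}. B i s)"
      using t by (intro sum.cong refl) (auto simp: c_def \<phi>_def B_def j_def k_def of_nat_diff)
    finally show ?thesis by (simp add: sum.cartesian_product)
  qed
  have "(\<Sum>i=1..N. B i m) = (\<Sum>i=1..N. \<Sum>s<Suc m. B i s) - (\<Sum>i=1..N. \<Sum>s<m. B i s)"
    by (simp add: sum.distrib)
  also have "\<dots> = 0"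
    using rectangle[of "Suc m"] rectangle[of m] assms(2) by simp
  finally show ?thesis by (simp add: B_def)
qed

text \<open>Translate \<open>p\<close> and \<open>q\<close> by their componentwise minimum to \<open>p0\<close> and \<open>q0\<close>. For \<open>j = p0 + (s, t)\<close>
  and \<open>k = q0 + (s, t)\<close> the substitution \<open>l = (s, t) - (x, y)\<close> makes the summand
  independent of \<open>s\<close> and \<open>t\<close>, and the summation set becomes a pair of opposite quadrants at
  \<open>(s, t)\<close>. Since the componentwise minimum of \<open>p0\<close> and \<open>q0\<close> is zero, only
  nonnegative \<open>x\<close>, \<open>y\<close> contribute.\<close>

lemma commuting_coeffs_mixed:
  assumes comm: "commuting_coeffs F G"
    and pq: "p \<in> pos_freqs" "q \<in> pos_freqs"
    and common: "(1 \<le> fst p \<and> 1 \<le> fst q) \<or> (1 \<le> snd p \<and> 1 \<le> snd q)"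
  shows "F p * G (- q) = G p * F (- q)"
proof -
  define x0 where "x0 = min (fst p) (fst q)"
  define y0 where "y0 = min (snd p) (snd q)"
  define p0 where "p0 = p - (x0, y0)"
  define q0 where "q0 = q - (x0, y0)"
  have base: "0 \<le> fst p0" "0 \<le> snd p0" "0 \<le> fst q0" "0 \<le> snd q0"
    "fst p0 = 0 \<or> fst q0 = 0" "snd p0 = 0 \<or> snd q0 = 0"
    by (auto simp: p0_def q0_def x0_def y0_def)
  define \<gamma> where "\<gamma> x y = F (p0 + (int x, int y)) * G (- (q0 + (int x, int y)))
      - G (p0 + (int x, int y)) * F (- (q0 + (int x, int y)))" for x y
  have sums: "((\<lambda>(x, y). \<gamma> x y) has_sum 0) {(x, y). x < s \<and> t < y \<or> s < x \<and> y < t}" (is "(_ has_sum 0) ?R")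
    for s t
  proof -
    define j where "j = p0 + (int s, int t)"
    define k where "k = q0 + (int s, int t)"
    define c where "c l = F (j - l) * G (l - k) - G (j - l) * F (l - k)" for l
    define \<phi> where "\<phi> = (\<lambda>(x, y). (int s - int x, int t - int y))"
    have c0: "c l = 0" if "j - l \<notin> plh_freqs \<or> l - k \<notin> plh_freqs" for l
      using commuting_coeffs_zero[OF comm, of "j - l"] commuting_coeffs_zero[OF comm, of "l - k"] that
      by (auto simp: c_def)
    have "j \<in> plh_freqs" "k \<in> plh_freqs"
      using base by (auto simp: j_def k_def mem_plh_freqs)
    then have "(c has_sum 0) (- plh_freqs)"
      unfolding c_def by (rule commuting_coeffs_sum[OF comm])
    moreover have "c l = 0" if l: "l \<in> - plh_freqs - \<phi> ` ?R" for l
    proof (rule ccontr)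
      assume "c l \<noteq> 0"
      then have mem: "j - l \<in> plh_freqs" "l - k \<in> plh_freqs" using c0 by blast+
      obtain x y where xy: "l = (x, y)" by (cases l)
      have sign: "(0 < x \<and> y < 0) \<or> (x < 0 \<and> 0 < y)"
        using l by (auto simp: xy mem_plh_freqs not_le)
      then have nonneg: "x \<le> int s" "y \<le> int t"
        using mem base by (auto simp: xy j_def k_def mem_plh_freqs)
      have "l = \<phi> (nat (int s - x), nat (int t - y))"
        using nonneg by (simp add: xy \<phi>_def)
      moreover have "(nat (int s - x), nat (int t - y)) \<in> ?R"
        using nonneg sign by auto
      ultimately show False using l by blast
    qed
    moreover have "\<phi> ` ?R \<subseteq> - plh_freqs"
      by (auto simp: \<phi>_def mem_plh_freqs)
    ultimately have "(c has_sum 0) (\<phi> ` ?R)"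
      by (subst has_sum_cong_neutral[of "- plh_freqs" _ c c]) auto
    moreover have "inj_on \<phi> ?R" by (auto simp: \<phi>_def inj_on_def)
    ultimately have "((c \<circ> \<phi>) has_sum 0) ?R"
      by (subst (asm) has_sum_reindex)
    moreover have "c \<circ> \<phi> = (\<lambda>(x, y). \<gamma> x y)"
    proof
      fix a :: "nat \<times> nat"
      have "j - \<phi> a = p0 + (int (fst a), int (snd a))" "\<phi> a - k = - (q0 + (int (fst a), int (snd a)))"
        by (auto simp: j_def k_def \<phi>_def prod_eq_iff split: prod.splits)
      then show "(c \<circ> \<phi>) a = (\<lambda>(x, y). \<gamma> x y) a"
        by (simp add: c_def \<gamma>_def split_def)
    qed
    ultimately show ?thesis by simp
  qed
  have nonneg: "0 \<le> x0" "0 \<le> y0" and "x0 \<noteq> 0 \<or> y0 \<noteq> 0"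
    using pq common by (auto simp: x0_def y0_def pos_freqs_def)
  then have "\<gamma> (nat x0) (nat y0) = 0"
    by (intro opposite_quadrant_sums[OF sums]) auto
  then show ?thesis using nonneg by (simp add: \<gamma>_def p0_def q0_def)
qed

text \<open>The column equations are the row equations of the sequences with exchanged coordinates.\<close>

lemma commuting_coeffs_trichotomy:
  assumes "commuting_coeffs F G"
  shows "(\<exists>\<alpha> \<beta>. \<not> (\<alpha> = 0 \<and> \<beta> = 0) \<and> (\<forall>k\<in>pos_freqs - {0}. \<alpha> * F k + \<beta> * G k = 0))
    \<or> (\<forall>k\<in>pos_freqs. fst k \<noteq> 0 \<longrightarrow> F k = 0 \<and> G k = 0)
    \<or> (\<forall>k\<in>pos_freqs. snd k \<noteq> 0 \<longrightarrow> F k = 0 \<and> G k = 0)"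
proof -
  define f where "f i j = F (int i, int j)" for i j
  define g where "g i j = G (int i, int j)" for i j
  have pos: "\<exists>i j. k = (int i, int j)" if "k \<in> pos_freqs" for k
    using that by (cases k) (auto simp: pos_freqs_def dest!: zero_le_imp_eq_int)
  have "(\<exists>\<alpha> \<beta>. \<not> (\<alpha> = 0 \<and> \<beta> = 0) \<and> (\<forall>i j. (i, j) \<noteq> (0, 0) \<longrightarrow> \<alpha> * f i j + \<beta> * g i j = 0))
    \<or> (\<forall>i j. i \<ge> 1 \<longrightarrow> f i j = 0 \<and> g i j = 0) \<or> (\<forall>i j. j \<ge> 1 \<longrightarrow> f i j = 0 \<and> g i j = 0)"
  proof (rule analytic_trichotomy)
    fix m n N :: nat assume n: "n \<ge> 1"
    show "(\<Sum>i=1..N. f i m * g (N - i) n - g i m * f (N - i) n) = 0"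
      unfolding f_def g_def by (rule commuting_coeffs_rows[OF assms n])
    show "(\<Sum>j=1..N. f m j * g n (N - j) - g m j * f n (N - j)) = 0"
      unfolding f_def g_def
      using commuting_coeffs_rows[OF commuting_coeffs_swap[OF assms] n, where m = m and N = N] by simp
  qed
  then show ?thesis
  proof (elim disjE exE conjE)
    fix \<alpha> \<beta> assume nz: "\<not> (\<alpha> = 0 \<and> \<beta> = 0)"
      and par: "\<forall>i j. (i, j) \<noteq> (0, 0) \<longrightarrow> \<alpha> * f i j + \<beta> * g i j = 0"
    have "\<alpha> * F k + \<beta> * G k = 0" if k: "k \<in> pos_freqs - {0}" for k
    proof -
      obtain i j where ij: "k = (int i, int j)" using pos[of k] k by blast
      with k have "(i, j) \<noteq> (0, 0)" by (auto simp: zero_prod_def)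
      with par have "\<alpha> * f i j + \<beta> * g i j = 0" by blast
      then show ?thesis by (simp add: ij f_def g_def)
    qed
    with nz show ?thesis by blast
  next
    assume *: "\<forall>i j. i \<ge> 1 \<longrightarrow> f i j = 0 \<and> g i j = 0"
    have "F k = 0 \<and> G k = 0" if k: "k \<in> pos_freqs" "fst k \<noteq> 0" for k
      using pos[OF k(1)] k(2) * by (fastforce simp: f_def g_def)
    then show ?thesis by blast
  next
    assume *: "\<forall>i j. j \<ge> 1 \<longrightarrow> f i j = 0 \<and> g i j = 0"
    have "F k = 0 \<and> G k = 0" if k: "k \<in> pos_freqs" "snd k \<noteq> 0" for k
      using pos[OF k(1)] k(2) * by (fastforce simp: f_def g_def)
    then show ?thesis by blast
  qed
qed

text \<open>The coefficient form of the first of the three conditions. The second condition is this one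
  for the sequences with exchanged coordinates.\<close>

definition separated_coeffs :: "(int \<times> int \<Rightarrow> complex) \<Rightarrow> (int \<times> int \<Rightarrow> complex) \<Rightarrow> bool" where
  "separated_coeffs F G \<longleftrightarrow> (\<forall>k\<in>pos_freqs.
     (snd k \<noteq> 0 \<longrightarrow> F k = 0 \<and> G k = 0) \<and> (fst k \<noteq> 0 \<longrightarrow> F (- k) = 0 \<and> G (- k) = 0))"

definition dependent_coeffs :: "(int \<times> int \<Rightarrow> complex) \<Rightarrow> (int \<times> int \<Rightarrow> complex) \<Rightarrow> bool" where
  "dependent_coeffs F G \<longleftrightarrow>
     (\<exists>\<alpha> \<beta>. \<not> (\<alpha> = 0 \<and> \<beta> = 0) \<and> (\<forall>k\<in>plh_freqs - {0}. \<alpha> * F k + \<beta> * G k = 0))"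

lemma plh_freqs_cases:
  assumes "k \<in> plh_freqs"
  obtains "k \<in> pos_freqs" | "- k \<in> pos_freqs"
  using assms by (auto simp: mem_plh_freqs pos_freqs_def)

text \<open>Let \<open>L q = \<alpha> F (- q) + \<beta> G (- q)\<close>. If \<open>u p = (F p, G p)\<close> is nonzero, it spans the line on which
  this form vanishes; so \<open>L q = 0\<close> whenever \<open>p\<close> and \<open>q\<close> share a positive coordinate, and the
  supports of the analytic part and of \<open>L\<close> must lie on different axes. It remains to see that all of the
  co-analytic part lies on the axis of \<open>q\<close>. By the trichotomy for that part, the alternative is
  that its vectors lie on one line, and then a nonzero one on which the form vanishes would make
  the form vanish on all.\<close>

lemma separated_if_analytic_part_dependent:
  assumes comm: "commuting_coeffs F G"
    and nz: "\<not> (\<alpha> = 0 \<and> \<beta> = 0)" and par: "\<And>k. k \<in> pos_freqs - {0} \<Longrightarrow> \<alpha> * F k + \<beta> * G k = 0"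
    and p: "p \<in> pos_freqs" "fst p \<noteq> 0" "\<not> (F p = 0 \<and> G p = 0)"
    and q: "q \<in> pos_freqs - {0}" "\<alpha> * F (- q) + \<beta> * G (- q) \<noteq> 0"
  shows "separated_coeffs F G"
proof -
  define L where "L k = \<alpha> * F (- k) + \<beta> * G (- k)" for k
  have disjoint: "L q' = 0"
    if "p' \<in> pos_freqs" "\<not> (F p' = 0 \<and> G p' = 0)" "q' \<in> pos_freqs"
      "(fst p' \<noteq> 0 \<and> fst q' \<noteq> 0) \<or> (snd p' \<noteq> 0 \<and> snd q' \<noteq> 0)" for p' q'
  proof -
    have "F p' * G (- q') = G p' * F (- q')"
      using that by (intro commuting_coeffs_mixed[OF comm]) (auto simp: pos_freqs_def)
    moreover have "\<alpha> * F p' + \<beta> * G p' = 0"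
      using that by (intro par) auto
    ultimately have "F p' * L q' = 0" "G p' * L q' = 0" unfolding L_def by algebra+
    with that(2) show ?thesis by auto
  qed
  have q_axis: "fst q = 0" "snd q \<noteq> 0"
  proof -
    show "fst q = 0" using disjoint[of p q] p q unfolding L_def by auto
    then show "snd q \<noteq> 0" using q(1) by (auto simp: prod_eq_iff)
  qed
  have "F k = 0 \<and> G k = 0" if "k \<in> pos_freqs" "snd k \<noteq> 0" for k
    using disjoint[of k q] that q q_axis unfolding L_def by blast
  moreover have "F (- k) = 0 \<and> G (- k) = 0" if k: "k \<in> pos_freqs" "fst k \<noteq> 0" for k
  proof (rule ccontr)
    assume nk: "\<not> (F (- k) = 0 \<and> G (- k) = 0)"
    have Lk: "L k = 0" using disjoint[of p k] p k by blast
    consider \<alpha>' \<beta>' where "\<not> (\<alpha>' = 0 \<and> \<beta>' = 0)" "\<And>k. k \<in> pos_freqs - {0} \<Longrightarrow> \<alpha>' * F (- k) + \<beta>' * G (- k) = 0"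
      | "\<forall>k\<in>pos_freqs. fst k \<noteq> 0 \<longrightarrow> F (- k) = 0 \<and> G (- k) = 0"
      | "\<forall>k\<in>pos_freqs. snd k \<noteq> 0 \<longrightarrow> F (- k) = 0 \<and> G (- k) = 0"
      using commuting_coeffs_trichotomy[OF commuting_coeffs_uminus[OF comm]] by blast
    then show False
    proof cases
      case 1
      have "k \<noteq> 0" using k(2) by auto
      then have "\<alpha>' * F (- k) + \<beta>' * G (- k) = 0" using 1(2) k by blast
      moreover have "\<alpha>' * F (- q) + \<beta>' * G (- q) = 0" using 1(2) q by blast
      moreover have "\<alpha> * F (- k) + \<beta> * G (- k) = 0" using Lk by (simp add: L_def)
      ultimately have "F (- k) * \<alpha>' * L q = 0" "G (- k) * \<alpha>' * L q = 0"
          "F (- k) * \<beta>' * L q = 0" "G (- k) * \<beta>' * L q = 0"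
        unfolding L_def by algebra+
      with nk 1(1) q(2) show False unfolding L_def by auto
    next
      case 2
      with nk k show False by blast
    next
      case 3
      with q q_axis show False by auto
    qed
  qed
  ultimately show ?thesis by (simp add: separated_coeffs_def)
qed

text \<open>If the linear relation extends to the negative frequencies, the sequences are dependent. If the
  analytic part is constant, the trichotomy for the co-analytic part is the conclusion. Otherwise
  the previous lemma applies, after an exchange of the coordinates when the analytic part lives
  on the second axis.\<close>

lemma commuting_coeffs_if_analytic_part_dependent:
  assumes comm: "commuting_coeffs F G"
    and nz: "\<not> (\<alpha> = 0 \<and> \<beta> = 0)" and par: "\<And>k. k \<in> pos_freqs - {0} \<Longrightarrow> \<alpha> * F k + \<beta> * G k = 0"
  shows "separated_coeffs F G \<or> separated_coeffs (\<lambda>k. F (prod.swap k)) (\<lambda>k. G (prod.swap k))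
    \<or> dependent_coeffs F G"
proof -
  have swap_pos: "prod.swap k \<in> pos_freqs \<longleftrightarrow> k \<in> pos_freqs" for k
    by (auto simp: pos_freqs_def)
  have swap_uminus: "prod.swap (- k) = - prod.swap k" for k :: "int \<times> int"
    by (simp add: prod_eq_iff)
  have dep: "dependent_coeffs F G"
    if "\<not> (\<alpha>' = 0 \<and> \<beta>' = 0)" "\<And>k. k \<in> pos_freqs - {0} \<Longrightarrow> \<alpha>' * F k + \<beta>' * G k = 0"
      "\<And>k. k \<in> pos_freqs - {0} \<Longrightarrow> \<alpha>' * F (- k) + \<beta>' * G (- k) = 0" for \<alpha>' \<beta>'
  proof -
    have "\<alpha>' * F k + \<beta>' * G k = 0" if "k \<in> plh_freqs - {0}" for k
    proof -
      from that have "k \<in> plh_freqs" by simp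
      then show ?thesis
        using \<open>k \<in> plh_freqs - {0}\<close> that(1) \<open>\<And>k. k \<in> pos_freqs - {0} \<Longrightarrow> \<alpha>' * F k + \<beta>' * G k = 0\<close>[of k]
          \<open>\<And>k. k \<in> pos_freqs - {0} \<Longrightarrow> \<alpha>' * F (- k) + \<beta>' * G (- k) = 0\<close>[of "- k"]
        by (cases rule: plh_freqs_cases) auto
    qed
    with that(1) show ?thesis unfolding dependent_coeffs_def by blast
  qed
  show ?thesis
  proof (cases "\<forall>k\<in>pos_freqs - {0}. \<alpha> * F (- k) + \<beta> * G (- k) = 0")
    case True
    with dep[OF nz] par show ?thesis by blast
  next
    case False
    then obtain q where q: "q \<in> pos_freqs - {0}" "\<alpha> * F (- q) + \<beta> * G (- q) \<noteq> 0" by blast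
    show ?thesis
    proof (cases "\<forall>k\<in>pos_freqs - {0}. F k = 0 \<and> G k = 0")
      case True
      then have zero: "F k = 0 \<and> G k = 0" if "k \<in> pos_freqs" "fst k \<noteq> 0 \<or> snd k \<noteq> 0" for k
        using that by (auto simp: prod_eq_iff)
      from commuting_coeffs_trichotomy[OF commuting_coeffs_uminus[OF comm]]
      show ?thesis
      proof (elim disjE exE conjE)
        fix \<alpha>' \<beta>' assume "\<not> (\<alpha>' = 0 \<and> \<beta>' = 0)"
          "\<forall>k\<in>pos_freqs - {0}. \<alpha>' * F (- k) + \<beta>' * G (- k) = 0"
        then have "dependent_coeffs F G" using True by (intro dep[of \<alpha>' \<beta>']) auto
        then show ?thesis by blast
      next
        assume "\<forall>k\<in>pos_freqs. fst k \<noteq> 0 \<longrightarrow> F (- k) = 0 \<and> G (- k) = 0"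
        then have "separated_coeffs F G" using zero unfolding separated_coeffs_def by blast
        then show ?thesis by blast
      next
        assume *: "\<forall>k\<in>pos_freqs. snd k \<noteq> 0 \<longrightarrow> F (- k) = 0 \<and> G (- k) = 0"
        have "separated_coeffs (\<lambda>k. F (prod.swap k)) (\<lambda>k. G (prod.swap k))"
          unfolding separated_coeffs_def swap_uminus
        proof
          fix k assume "k \<in> pos_freqs"
          then have "prod.swap k \<in> pos_freqs" by (simp only: swap_pos)
          then show "(snd k \<noteq> 0 \<longrightarrow> F (prod.swap k) = 0 \<and> G (prod.swap k) = 0) \<and>
              (fst k \<noteq> 0 \<longrightarrow> F (- prod.swap k) = 0 \<and> G (- prod.swap k) = 0)"
            using * zero by (metis fst_swap snd_swap)
        qed
        then show ?thesis by blast
      qed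
    next
      case False
      then obtain p where p: "p \<in> pos_freqs - {0}" "\<not> (F p = 0 \<and> G p = 0)" by blast
      show ?thesis
      proof (cases "fst p = 0")
        case False
        then have "separated_coeffs F G"
          using p by (intro separated_if_analytic_part_dependent[OF comm nz par _ _ _ q]) auto
        then show ?thesis by blast
      next
        case True
        have "separated_coeffs (\<lambda>k. F (prod.swap k)) (\<lambda>k. G (prod.swap k))"
        proof (rule separated_if_analytic_part_dependent[OF commuting_coeffs_swap[OF comm] nz])
          show "\<alpha> * F (prod.swap k) + \<beta> * G (prod.swap k) = 0" if "k \<in> pos_freqs - {0}" for k
            using that by (intro par) (auto simp: swap_pos prod_eq_iff)
          show "prod.swap p \<in> pos_freqs" using p by (simp only: swap_pos) simp
          show "fst (prod.swap p) \<noteq> 0" using p(1) True by (auto simp: prod_eq_iff)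
          show "\<not> (F (prod.swap (prod.swap p)) = 0 \<and> G (prod.swap (prod.swap p)) = 0)"
            using p(2) by simp
          show "prod.swap q \<in> pos_freqs - {0}" using q(1) by (auto simp: swap_pos prod_eq_iff)
          show "\<alpha> * F (prod.swap (- prod.swap q)) + \<beta> * G (prod.swap (- prod.swap q)) \<noteq> 0"
            using q(2) by (simp add: swap_uminus)
        qed
        then show ?thesis by blast
      qed
    qed
  qed
qed

text \<open>If the analytic or the co-analytic part satisfies a linear relation, the previous lemma applies
  (to the reflected sequences in the second case). Otherwise both parts live on an axis each.
  If it is the same axis, any frequencies \<open>k\<close> and \<open>- q\<close> in their supports share a positive
  coordinate, so a nonzero vector of the co-analytic part is parallel to all vectors of the
  analytic part, and that part does satisfy a linear relation.\<close>

theorem commuting_coeffs_classification: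
  assumes comm: "commuting_coeffs F G"
  shows "separated_coeffs F G \<or> separated_coeffs (\<lambda>k. F (prod.swap k)) (\<lambda>k. G (prod.swap k))
    \<or> dependent_coeffs F G"
proof -
  define par where "par H K \<longleftrightarrow> (\<exists>\<alpha> \<beta> :: complex. \<not> (\<alpha> = 0 \<and> \<beta> = 0) \<and> (\<forall>k\<in>pos_freqs - {0}. \<alpha> * H k + \<beta> * K k = 0))"
    for H K :: "int \<times> int \<Rightarrow> complex"
  define Fn where "Fn k = F (- k)" for k
  define Gn where "Gn k = G (- k)" for k
  have commn: "commuting_coeffs Fn Gn"
    unfolding Fn_def Gn_def by (rule commuting_coeffs_uminus[OF comm])
  have swap_pos: "prod.swap k \<in> pos_freqs \<longleftrightarrow> k \<in> pos_freqs" for k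
    by (auto simp: pos_freqs_def)
  have swap_uminus: "prod.swap (- k) = - prod.swap k" for k :: "int \<times> int"
    by (simp add: prod_eq_iff)
  consider "par F G" | "par Fn Gn" | "\<not> par F G" "\<not> par Fn Gn" by blast
  then show ?thesis
  proof cases
    case 1
    then show ?thesis
      using commuting_coeffs_if_analytic_part_dependent[OF comm] unfolding par_def by blast
  next
    case 2
    then have "separated_coeffs Fn Gn \<or> separated_coeffs (\<lambda>k. Fn (prod.swap k)) (\<lambda>k. Gn (prod.swap k))
        \<or> dependent_coeffs Fn Gn"
      using commuting_coeffs_if_analytic_part_dependent[OF commn] unfolding par_def by blast
    moreover have "separated_coeffs (\<lambda>k. F (prod.swap k)) (\<lambda>k. G (prod.swap k))" if "separated_coeffs Fn Gn"
      using that unfolding separated_coeffs_def Fn_def Gn_def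
      by (metis add.inverse_inverse swap_pos swap_uminus fst_swap snd_swap)
    moreover have "separated_coeffs F G" if "separated_coeffs (\<lambda>k. Fn (prod.swap k)) (\<lambda>k. Gn (prod.swap k))"
      using that unfolding separated_coeffs_def Fn_def Gn_def
      by (metis add.inverse_inverse swap_pos swap_uminus fst_swap snd_swap swap_swap)
    moreover have "dependent_coeffs F G" if "dependent_coeffs Fn Gn"
    proof -
      have "- k \<in> plh_freqs - {0} \<longleftrightarrow> k \<in> plh_freqs - {0}" for k
        by (auto simp: mem_plh_freqs)
      then show ?thesis
        using that unfolding dependent_coeffs_def Fn_def Gn_def by (metis add.inverse_inverse)
    qed
    ultimately show ?thesis by blast
  next
    case 3
    have tri: "(\<forall>k\<in>pos_freqs. fst k \<noteq> 0 \<longrightarrow> F k = 0 \<and> G k = 0) \<or> (\<forall>k\<in>pos_freqs. snd k \<noteq> 0 \<longrightarrow> F k = 0 \<and> G k = 0)"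
      using commuting_coeffs_trichotomy[OF comm] 3(1) unfolding par_def by blast
    have trin: "(\<forall>k\<in>pos_freqs. fst k \<noteq> 0 \<longrightarrow> Fn k = 0 \<and> Gn k = 0) \<or> (\<forall>k\<in>pos_freqs. snd k \<noteq> 0 \<longrightarrow> Fn k = 0 \<and> Gn k = 0)"
      using commuting_coeffs_trichotomy[OF commn] 3(2) unfolding par_def by blast
    obtain q where q: "q \<in> pos_freqs - {0}" "\<not> (Fn q = 0 \<and> Gn q = 0)"
      using 3(2) unfolding par_def by (metis add_0 mult_zero_right one_neq_zero)
    have proportional: "par F G"
      if "\<And>k. k \<in> pos_freqs - {0} \<Longrightarrow> \<not> (F k = 0 \<and> G k = 0) \<Longrightarrow>
        (fst k \<noteq> 0 \<and> fst q \<noteq> 0) \<or> (snd k \<noteq> 0 \<and> snd q \<noteq> 0)"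
    proof -
      \<comment> \<open>the relation that expresses being parallel to the vector at \<open>- q\<close>\<close>
      have "Gn q * F k + - Fn q * G k = 0" if k: "k \<in> pos_freqs - {0}" for k
      proof (cases "F k = 0 \<and> G k = 0")
        case False
        have "F k * G (- q) = G k * F (- q)"
          using k q(1) \<open>\<And>k. k \<in> pos_freqs - {0} \<Longrightarrow> \<not> (F k = 0 \<and> G k = 0) \<Longrightarrow>
            (fst k \<noteq> 0 \<and> fst q \<noteq> 0) \<or> (snd k \<noteq> 0 \<and> snd q \<noteq> 0)\<close>[OF k False]
          by (intro commuting_coeffs_mixed[OF comm]) (auto simp: pos_freqs_def)
        then show ?thesis by (simp add: Fn_def Gn_def mult.commute)
      qed auto
      moreover have "\<not> (Gn q = 0 \<and> - Fn q = 0)" using q(2) by auto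
      ultimately show ?thesis unfolding par_def by blast
    qed
    from tri trin show ?thesis
    proof (elim disjE)
      assume z: "\<forall>k\<in>pos_freqs. fst k \<noteq> 0 \<longrightarrow> F k = 0 \<and> G k = 0" "\<forall>k\<in>pos_freqs. fst k \<noteq> 0 \<longrightarrow> Fn k = 0 \<and> Gn k = 0"
      have "par F G"
        using z q by (intro proportional) (auto simp: prod_eq_iff)
      with 3 show ?thesis by blast
    next
      assume z: "\<forall>k\<in>pos_freqs. snd k \<noteq> 0 \<longrightarrow> F k = 0 \<and> G k = 0" "\<forall>k\<in>pos_freqs. snd k \<noteq> 0 \<longrightarrow> Fn k = 0 \<and> Gn k = 0"
      have "par F G"
        using z q by (intro proportional) (auto simp: prod_eq_iff)
      with 3 show ?thesis by blast
    next
      assume "\<forall>k\<in>pos_freqs. fst k \<noteq> 0 \<longrightarrow> F k = 0 \<and> G k = 0" "\<forall>k\<in>pos_freqs. snd k \<noteq> 0 \<longrightarrow> Fn k = 0 \<and> Gn k = 0"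
      then have "separated_coeffs (\<lambda>k. F (prod.swap k)) (\<lambda>k. G (prod.swap k))"
        unfolding separated_coeffs_def Fn_def Gn_def swap_uminus
        by (metis swap_pos fst_swap snd_swap)
      then show ?thesis by blast
    next
      assume "\<forall>k\<in>pos_freqs. snd k \<noteq> 0 \<longrightarrow> F k = 0 \<and> G k = 0" "\<forall>k\<in>pos_freqs. fst k \<noteq> 0 \<longrightarrow> Fn k = 0 \<and> Gn k = 0"
      then have "separated_coeffs F G" unfolding separated_coeffs_def Fn_def Gn_def by blast
      then show ?thesis by blast
    qed
  qed
qed

section \<open>Toeplitz operators in terms of Fourier coefficients\<close>

lemma plh_hardy2_L2: "f \<in> plh_hardy2 \<Longrightarrow> f \<in> L2 torus_measure"
  using plh_hardy2_spectral spectral_L2 by blast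

lemma fourier_plh_zero: "f \<in> plh_hardy2 \<Longrightarrow> k \<notin> plh_freqs \<Longrightarrow> fourier f k = 0"
  by (rule fourier_spectral[OF plh_hardy2_spectral])

lemma plh_hardy2_spectral_UNIV: "f \<in> plh_hardy2 \<Longrightarrow> f \<in> spectral UNIV"
  using plh_hardy2_spectral spectral_mono by blast

text \<open>The convolution formula for \<open>f (g h)\<close> sums over all frequencies; the one for \<open>f\<close> times the
  projection of \<open>g h\<close> has the same terms, restricted to \<open>plh_freqs\<close>.\<close>

lemma fourier_toeplitz_toeplitz:
  assumes f: "f \<in> plh_hardy2" "f \<in> Linf torus_measure"
    and g: "g \<in> Linf torus_measure" and h: "h \<in> L2 torus_measure" and j: "j \<in> plh_freqs"
  shows "((\<lambda>l. fourier f (j - l) * fourier (\<lambda>z. g z * h z) l) has_sum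
    (fourier (\<lambda>z. f z * (g z * h z)) j - fourier (toeplitz f (toeplitz g h)) j)) (- plh_freqs)"
proof -
  have gh: "(\<lambda>z. g z * h z) \<in> L2 torus_measure" by (rule L2_mult_Linf[OF g h])
  define u where "u = toeplitz g h"
  have u: "u \<in> plh_hardy2" "\<And>k. k \<in> plh_freqs \<Longrightarrow> fourier u k = fourier (\<lambda>z. g z * h z) k"
    unfolding u_def toeplitz_def using projQ_fourier[OF gh] by auto
  have "fourier (toeplitz f u) j = fourier (\<lambda>z. f z * u z) j"
    unfolding toeplitz_def using projQ_fourier(2)[OF L2_mult_Linf[OF f(2) plh_hardy2_L2[OF u(1)]] j] .
  then have "((\<lambda>k. fourier f (j - k) * fourier u k) has_sum fourier (toeplitz f u) j) UNIV"
    using fourier_mult[OF plh_hardy2_spectral_UNIV[OF f(1)] plh_hardy2_L2[OF u(1)], of j] by simp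
  then have "((\<lambda>k. fourier f (j - k) * fourier (\<lambda>z. g z * h z) k) has_sum fourier (toeplitz f u) j) plh_freqs"
    by (rule has_sum_cong_neutral[THEN iffD1, rotated 3])
       (auto simp: u(2) fourier_plh_zero[OF u(1)])
  from has_sum_Diff[OF fourier_mult[OF plh_hardy2_spectral_UNIV[OF f(1)] gh, of j] this]
  show ?thesis by (simp add: u_def Compl_eq_Diff_UNIV)
qed

text \<open>The term \<open>f g h\<close> in the previous lemma is symmetric in \<open>f\<close> and \<open>g\<close> and cancels. Both products of operators
  take values in the pluriharmonic Hardy space, where coefficients determine a function.\<close>

lemma toeplitz_commute_iff:
  assumes f: "f \<in> plh_hardy2" "f \<in> Linf torus_measure" and g: "g \<in> plh_hardy2" "g \<in> Linf torus_measure"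
    and h: "h \<in> L2 torus_measure"
  shows "(AE z in torus_measure. toeplitz f (toeplitz g h) z = toeplitz g (toeplitz f h) z) \<longleftrightarrow>
    (\<forall>j\<in>plh_freqs. ((\<lambda>l. fourier f (j - l) * fourier (\<lambda>z. g z * h z) l
        - fourier g (j - l) * fourier (\<lambda>z. f z * h z) l) has_sum 0) (- plh_freqs))"
proof -
  define u where "u = toeplitz f (toeplitz g h)"
  define v where "v = toeplitz g (toeplitz f h)"
  have toeplitz_plh: "toeplitz a b \<in> plh_hardy2" if "a \<in> Linf torus_measure" "b \<in> L2 torus_measure" for a b
    unfolding toeplitz_def by (intro projQ_fourier L2_mult_Linf that)
  have uv: "u \<in> spectral plh_freqs" "v \<in> spectral plh_freqs"
    unfolding u_def v_def
    by (intro plh_hardy2_spectral toeplitz_plh f g plh_hardy2_L2[OF toeplitz_plh] h)+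
  note L2 = uv[THEN spectral_L2]
  have "(AE z in torus_measure. u z = v z) \<longleftrightarrow> (\<forall>j\<in>plh_freqs. fourier u j = fourier v j)"
  proof
    assume "AE z in torus_measure. u z = v z"
    then show "\<forall>j\<in>plh_freqs. fourier u j = fourier v j"
      using fourier_cong_AE L2 L2_measurable by blast
  next
    assume "\<forall>j\<in>plh_freqs. fourier u j = fourier v j"
    then have "AE z in torus_measure. u z - v z = 0"
      by (intro spectral_eq_zero[OF spectral_diff[OF uv]]) (simp add: fourier_diff L2)
    then show "AE z in torus_measure. u z = v z" by simp
  qed
  also have "\<dots> \<longleftrightarrow> (\<forall>j\<in>plh_freqs. ((\<lambda>l. fourier f (j - l) * fourier (\<lambda>z. g z * h z) l
        - fourier g (j - l) * fourier (\<lambda>z. f z * h z) l) has_sum 0) (- plh_freqs))"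
  proof (intro ball_cong refl)
    fix j assume j: "j \<in> plh_freqs"
    have "(\<lambda>z. f z * (g z * h z)) = (\<lambda>z. g z * (f z * h z))" by (simp add: mult_ac)
    then have sum: "((\<lambda>l. fourier f (j - l) * fourier (\<lambda>z. g z * h z) l
        - fourier g (j - l) * fourier (\<lambda>z. f z * h z) l) has_sum (fourier v j - fourier u j)) (- plh_freqs)"
      using has_sum_diff[OF fourier_toeplitz_toeplitz[OF f g(2) h j] fourier_toeplitz_toeplitz[OF g f(2) h j]]
      by (simp add: u_def v_def)
    show "fourier u j = fourier v j \<longleftrightarrow> ((\<lambda>l. fourier f (j - l) * fourier (\<lambda>z. g z * h z) l
        - fourier g (j - l) * fourier (\<lambda>z. f z * h z) l) has_sum 0) (- plh_freqs)"
      using sum has_sum_unique[OF sum, of 0] by auto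
  qed
  finally show ?thesis by (simp add: u_def v_def)
qed

text \<open>The criterion for \<open>h\<close> a character, which shifts coefficients by its frequency.\<close>

lemma commuting_toeplitz_coeffs:
  assumes f: "f \<in> plh_hardy2" "f \<in> Linf torus_measure" and g: "g \<in> plh_hardy2" "g \<in> Linf torus_measure"
    and comm: "\<forall>h\<in>plh_hardy2. AE z in torus_measure. toeplitz f (toeplitz g h) z = toeplitz g (toeplitz f h) z"
  shows "commuting_coeffs (fourier f) (fourier g)"
  unfolding commuting_coeffs_def
proof (intro conjI ballI allI impI)
  show "fourier f k = 0" "fourier g k = 0" if "k \<notin> plh_freqs" for k
    using fourier_plh_zero f(1) g(1) that by simp_all
  fix j k assume j: "j \<in> plh_freqs" and k: "k \<in> plh_freqs"
  obtain h where h: "h \<in> plh_hardy2" "\<And>z. z \<in> space torus_measure \<Longrightarrow> h z = character k z"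
    using character_plh_hardy2[OF k] by blast
  have shift: "fourier (\<lambda>z. a z * h z) l = fourier a (l - k)" for a l
  proof -
    have "fourier (\<lambda>z. a z * h z) l = fourier (\<lambda>z. a z * character k z) l"
      unfolding fourier_def L2_inner_def by (intro Bochner_Integration.integral_cong) (auto simp: h(2))
    then show ?thesis by (simp add: fourier_mult_character)
  qed
  show "((\<lambda>l. fourier f (j - l) * fourier g (l - k) - fourier g (j - l) * fourier f (l - k)) has_sum 0) (- plh_freqs)"
    using comm h(1) j toeplitz_commute_iff[OF f g plh_hardy2_L2[OF h(1)]] by (simp add: shift)
qed

text \<open>Let \<open>l\<close> lie outside \<open>plh_freqs\<close>, in one of two opposite open quadrants. From a frequency in the one quadrant, steps
  along the half axes that support \<open>f\<close> and \<open>g\<close> never reach \<open>plh_freqs\<close>, so \<open>F (j - l) = G (j - l) = 0\<close>;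
  and a frequency in the other quadrant is never reached from \<open>plh_freqs\<close>, so the coefficients of
  \<open>f h\<close> and \<open>g h\<close> at \<open>l\<close> vanish.\<close>

lemma toeplitz_commute_if_separated:
  assumes f: "f \<in> plh_hardy2" "f \<in> Linf torus_measure" and g: "g \<in> plh_hardy2" "g \<in> Linf torus_measure"
    and h: "h \<in> plh_hardy2"
    and sep: "separated_coeffs (fourier f) (fourier g)
      \<or> separated_coeffs (\<lambda>k. fourier f (prod.swap k)) (\<lambda>k. fourier g (prod.swap k))"
  shows "AE z in torus_measure. toeplitz f (toeplitz g h) z = toeplitz g (toeplitz f h) z"
proof -
  have zero: "fourier f k = 0" "fourier g k = 0" "fourier h k = 0" if "k \<notin> plh_freqs" for k
    using fourier_plh_zero f(1) g(1) h that by simp_all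
  \<comment> \<open>The sign \<open>s\<close> is \<open>1\<close> if the analytic parts are functions of the first variable and
    \<open>-1\<close> if they are functions of the second one; it lets one argument serve both cases.\<close>
  have "\<exists>s::int. s \<noteq> 0 \<and> (\<forall>a b. (fourier f (a, b) \<noteq> 0 \<or> fourier g (a, b) \<noteq> 0) \<longrightarrow> (b = 0 \<and> 0 \<le> s * a) \<or> (a = 0 \<and> s * b \<le> 0))"
    using sep
  proof
    assume s: "separated_coeffs (fourier f) (fourier g)"
    have "(b = 0 \<and> 0 \<le> 1 * a) \<or> (a = 0 \<and> 1 * b \<le> 0)" if "fourier f (a, b) \<noteq> 0 \<or> fourier g (a, b) \<noteq> 0" for a b
    proof -
      have "(a, b) \<in> plh_freqs" using that zero by blast
      then show ?thesis
        using s[unfolded separated_coeffs_def, rule_format, of "(a, b)"]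
          s[unfolded separated_coeffs_def, rule_format, of "(- a, - b)"] that
        by (auto simp: mem_plh_freqs pos_freqs_def)
    qed
    then show ?thesis by (intro exI[of _ 1]) auto
  next
    assume s: "separated_coeffs (\<lambda>k. fourier f (prod.swap k)) (\<lambda>k. fourier g (prod.swap k))"
    have "(b = 0 \<and> 0 \<le> - 1 * a) \<or> (a = 0 \<and> - 1 * b \<le> 0)" if "fourier f (a, b) \<noteq> 0 \<or> fourier g (a, b) \<noteq> 0" for a b
    proof -
      have "(a, b) \<in> plh_freqs" using that zero by blast
      then show ?thesis
        using s[unfolded separated_coeffs_def, rule_format, of "(b, a)"]
          s[unfolded separated_coeffs_def, rule_format, of "(- b, - a)"] that
        by (auto simp: mem_plh_freqs pos_freqs_def)
    qed
    then show ?thesis by (intro exI[of _ "- 1"]) auto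
  qed
  then obtain s :: int where s: "s \<noteq> 0" and axes:
    "\<And>a b. fourier f (a, b) \<noteq> 0 \<or> fourier g (a, b) \<noteq> 0 \<Longrightarrow> (b = 0 \<and> 0 \<le> s * a) \<or> (a = 0 \<and> s * b \<le> 0)"
    by blast
  have "fourier f (j - l) * fourier (\<lambda>z. g z * h z) l - fourier g (j - l) * fourier (\<lambda>z. f z * h z) l = 0"
    if j: "j \<in> plh_freqs" and l: "l \<notin> plh_freqs" for j l
  proof -
    obtain j1 j2 l1 l2 where jl: "j = (j1, j2)" "l = (l1, l2)" by (cases j, cases l)
    consider "0 < s * l1" "s * l2 < 0" | "s * l1 < 0" "0 < s * l2"
      using l s by (cases "0 < s") (auto simp: jl mem_plh_freqs not_le zero_less_mult_iff mult_less_0_iff)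
    then show ?thesis
    proof cases
      case 1
      have "\<not> (j2 - l2 = 0 \<and> 0 \<le> s * (j1 - l1))" "\<not> (j1 - l1 = 0 \<and> s * (j2 - l2) \<le> 0)"
        using 1 j s by (auto simp: jl mem_plh_freqs algebra_simps zero_less_mult_iff mult_less_0_iff mult_le_0_iff zero_le_mult_iff)
      then have "fourier f (j - l) = 0" "fourier g (j - l) = 0"
        using axes[of "j1 - l1" "j2 - l2"] by (auto simp: jl)
      then show ?thesis by simp
    next
      case 2
      have "fourier (\<lambda>z. a z * h z) l = 0" if a: "a \<in> plh_hardy2"
        "\<And>a1 a2. fourier a (a1, a2) \<noteq> 0 \<Longrightarrow> (a2 = 0 \<and> 0 \<le> s * a1) \<or> (a1 = 0 \<and> s * a2 \<le> 0)" for a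
      proof -
        have "fourier a (l - k) * fourier h k = 0" for k
        proof (rule ccontr)
          assume nz: "fourier a (l - k) * fourier h k \<noteq> 0"
          obtain k1 k2 where k: "k = (k1, k2)" by (cases k)
          have "(k1, k2) \<in> plh_freqs" using nz zero(3)[of k] by (auto simp: k)
          moreover have "(l2 - k2 = 0 \<and> 0 \<le> s * (l1 - k1)) \<or> (l1 - k1 = 0 \<and> s * (l2 - k2) \<le> 0)"
            using nz by (intro a(2)) (auto simp: jl k)
          ultimately show False
            using 2 s by (auto simp: mem_plh_freqs algebra_simps zero_less_mult_iff mult_less_0_iff mult_le_0_iff zero_le_mult_iff)
        qed
        then have "((\<lambda>k. fourier a (l - k) * fourier h k) has_sum 0) UNIV" by (intro has_sum_0)
        with fourier_mult[OF plh_hardy2_spectral_UNIV[OF a(1)] plh_hardy2_L2[OF h]] show ?thesis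
          by (rule has_sum_unique)
      qed
      with f(1) g(1) axes have "fourier (\<lambda>z. f z * h z) l = 0" "fourier (\<lambda>z. g z * h z) l = 0" by blast+
      then show ?thesis by simp
    qed
  qed
  then show ?thesis
    unfolding toeplitz_commute_iff[OF f g plh_hardy2_L2[OF h]] by (intro ballI has_sum_0) auto
qed

text \<open>Outside \<open>plh_freqs\<close> the constant of the linear relation has no effect: \<open>h\<close> has no coefficient at
  \<open>l\<close>, and \<open>j - l \<noteq> 0\<close>. So \<open>f\<close> and \<open>g\<close> contribute proportional coefficients to both factors, and
  every determinant vanishes.\<close>

lemma toeplitz_commute_if_dependent:
  assumes f: "f \<in> plh_hardy2" "f \<in> Linf torus_measure" and g: "g \<in> plh_hardy2" "g \<in> Linf torus_measure"
    and h: "h \<in> plh_hardy2"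
    and dep: "dependent_coeffs (fourier f) (fourier g)"
  shows "AE z in torus_measure. toeplitz f (toeplitz g h) z = toeplitz g (toeplitz f h) z"
proof -
  note L2 = plh_hardy2_L2[OF h]
  have zero: "fourier f k = 0" "fourier g k = 0" "fourier h k = 0" if "k \<notin> plh_freqs" for k
    using fourier_plh_zero f(1) g(1) h that by simp_all
  obtain \<alpha> \<beta> where nz: "\<not> (\<alpha> = 0 \<and> \<beta> = 0)"
    and dep: "\<And>k. k \<noteq> 0 \<Longrightarrow> \<alpha> * fourier f k + \<beta> * fourier g k = 0"
    using dep zero unfolding dependent_coeffs_def by (metis DiffI add_0 mult_zero_right singletonD)
  have "fourier f (j - l) * fourier (\<lambda>z. g z * h z) l - fourier g (j - l) * fourier (\<lambda>z. f z * h z) l = 0"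
    if j: "j \<in> plh_freqs" and l: "l \<notin> plh_freqs" for j l
  proof -
    have "((\<lambda>k. \<alpha> * (fourier f (l - k) * fourier h k) + \<beta> * (fourier g (l - k) * fourier h k)) has_sum
        (\<alpha> * fourier (\<lambda>z. f z * h z) l + \<beta> * fourier (\<lambda>z. g z * h z) l)) UNIV"
      by (intro has_sum_add has_sum_cmult_right fourier_mult plh_hardy2_spectral_UNIV f g L2)
    moreover have "\<alpha> * (fourier f (l - k) * fourier h k) + \<beta> * (fourier g (l - k) * fourier h k) = 0" for k
    proof (cases "k = l")
      case True
      then show ?thesis using zero(3)[OF l] by simp
    next
      case False
      then have "\<alpha> * fourier f (l - k) + \<beta> * fourier g (l - k) = 0" by (intro dep) simp
      then show ?thesis by algebra
    qed
    then have "((\<lambda>k. \<alpha> * (fourier f (l - k) * fourier h k) + \<beta> * (fourier g (l - k) * fourier h k)) has_sum 0) UNIV"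
      by (intro has_sum_0)
    ultimately have "\<alpha> * fourier (\<lambda>z. f z * h z) l + \<beta> * fourier (\<lambda>z. g z * h z) l = 0"
      by (rule has_sum_unique)
    moreover have "\<alpha> * fourier f (j - l) + \<beta> * fourier g (j - l) = 0"
      using j l by (intro dep) auto
    ultimately have "\<alpha> * (fourier f (j - l) * fourier (\<lambda>z. g z * h z) l - fourier g (j - l) * fourier (\<lambda>z. f z * h z) l) = 0"
      "\<beta> * (fourier f (j - l) * fourier (\<lambda>z. g z * h z) l - fourier g (j - l) * fourier (\<lambda>z. f z * h z) l) = 0"
      by algebra+
    with nz show ?thesis by auto
  qed
  then show ?thesis
    unfolding toeplitz_commute_iff[OF f g L2] by (intro ballI has_sum_0) auto
qed

section \<open>The three conditions in terms of Fourier coefficients\<close>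

lemma plus_part_fourier:
  assumes "f \<in> plh_hardy2"
  shows "plus_part f \<in> spectral UNIV"
    and "fourier (plus_part f) k = (if k \<in> pos_freqs then fourier f k else 0)"
proof -
  note L2 = plh_hardy2_L2[OF assms]
  have "projP f \<in> spectral pos_freqs" using projP_fourier(1)[OF L2] by (simp add: hardy2_eq_spectral)
  then show "plus_part f \<in> spectral UNIV"
    "fourier (plus_part f) k = (if k \<in> pos_freqs then fourier f k else 0)"
    unfolding plus_part_def using projP_fourier(2)[OF L2] fourier_spectral spectral_mono[OF subset_UNIV] by auto
qed

lemma minus_part_fourier:
  assumes "f \<in> plh_hardy2"
  shows "minus_part f \<in> spectral UNIV"
    and "fourier (minus_part f) k = (if k \<in> pos_freqs then 0 else fourier f k)"
proof -
  note L2 = plh_hardy2_L2[OF assms]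
  have P: "projP f \<in> spectral UNIV" using plus_part_fourier(1)[OF assms] by (simp add: plus_part_def)
  have Q: "projQ f \<in> plh_hardy2" by (rule projQ_fourier(1)[OF L2])
  show "minus_part f \<in> spectral UNIV"
    unfolding minus_part_def by (intro spectral_diff plh_hardy2_spectral_UNIV Q P)
  have "fourier (projQ f) k = fourier f k"
    using projQ_fourier(2)[OF L2] fourier_plh_zero Q assms by (cases "k \<in> plh_freqs") auto
  then show "fourier (minus_part f) k = (if k \<in> pos_freqs then 0 else fourier f k)"
    using plus_part_fourier(2)[OF assms, of k]
    by (simp add: minus_part_def plus_part_def fourier_diff spectral_L2[OF P] plh_hardy2_L2[OF Q])
qed

text \<open>The co-analytic part is indexed by the frequencies outside the nonnegative quadrant, while
  \<open>separated_coeffs\<close> speaks of \<open>- k\<close> with \<open>k\<close> in that quadrant; since coefficients vanish outside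
  \<open>plh_freqs\<close> the two descriptions agree.\<close>

lemma separated_coeffs_iff:
  assumes "f \<in> plh_hardy2" "g \<in> plh_hardy2"
  shows "separated_coeffs (fourier f) (fourier g) \<longleftrightarrow>
      depends_only_on_z1 (plus_part f) \<and> depends_only_on_z1 (plus_part g) \<and>
      depends_only_on_z2 (minus_part f) \<and> depends_only_on_z2 (minus_part g)" (is ?A)
    and "separated_coeffs (\<lambda>k. fourier f (prod.swap k)) (\<lambda>k. fourier g (prod.swap k)) \<longleftrightarrow>
      depends_only_on_z2 (plus_part f) \<and> depends_only_on_z2 (plus_part g) \<and>
      depends_only_on_z1 (minus_part f) \<and> depends_only_on_z1 (minus_part g)" (is ?B)
proof -
  have zero: "fourier f k = 0 \<and> fourier g k = 0" if "k \<notin> plh_freqs" for k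
    using fourier_plh_zero assms that by simp
  have neg: "(\<forall>k. k \<notin> pos_freqs \<longrightarrow> P k) \<longleftrightarrow> (\<forall>k\<in>pos_freqs - {0}. P (- k))"
    if "\<And>k. k \<notin> plh_freqs \<Longrightarrow> P k" for P
  proof (intro iffI ballI allI impI)
    fix k assume "\<forall>k. k \<notin> pos_freqs \<longrightarrow> P k" "k \<in> pos_freqs - {0}"
    moreover from this have "- k \<notin> pos_freqs" by (cases k) (auto simp: pos_freqs_def zero_prod_def)
    ultimately show "P (- k)" by blast
  next
    fix k assume *: "\<forall>k\<in>pos_freqs - {0}. P (- k)" "k \<notin> pos_freqs"
    show "P k"
    proof (cases "k \<in> plh_freqs")
      case True
      then have "- k \<in> pos_freqs - {0}" using *(2) by (cases k) (auto simp: pos_freqs_def mem_plh_freqs zero_prod_def)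
      with *(1) have "P (- (- k))" by blast
      then show ?thesis by simp
    qed (rule that)
  qed
  have swap: "(\<forall>k\<in>pos_freqs. P (prod.swap k)) \<longleftrightarrow> (\<forall>k\<in>pos_freqs. P k)" for P
  proof -
    have "prod.swap ` pos_freqs = pos_freqs"
      by (auto simp: pos_freqs_def image_iff prod.swap_def)
    then show ?thesis by (metis image_eqI imageE)
  qed
  have swap_uminus: "prod.swap (- k) = - prod.swap k" for k :: "int \<times> int"
    by (simp add: prod_eq_iff)
  have nonzero: "k \<in> pos_freqs - {0} \<longleftrightarrow> k \<in> pos_freqs" if "fst k \<noteq> 0 \<or> snd k \<noteq> 0" for k
    using that by auto
  have parts: "separated_coeffs F G \<longleftrightarrow> (\<forall>k\<in>pos_freqs. snd k \<noteq> 0 \<longrightarrow> F k = 0 \<and> G k = 0) \<and>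
      (\<forall>k\<in>pos_freqs - {0}. fst k \<noteq> 0 \<longrightarrow> F (- k) = 0 \<and> G (- k) = 0)" for F G
    unfolding separated_coeffs_def using nonzero by blast
  show ?A
    unfolding parts depends_only_on_z1_iff[OF plus_part_fourier(1)[OF assms(1)]]
      depends_only_on_z1_iff[OF plus_part_fourier(1)[OF assms(2)]]
      depends_only_on_z2_iff[OF minus_part_fourier(1)[OF assms(1)]]
      depends_only_on_z2_iff[OF minus_part_fourier(1)[OF assms(2)]]
      plus_part_fourier(2)[OF assms(1)] plus_part_fourier(2)[OF assms(2)]
      minus_part_fourier(2)[OF assms(1)] minus_part_fourier(2)[OF assms(2)]
    using neg[of "\<lambda>k. fst k \<noteq> 0 \<longrightarrow> fourier f k = 0 \<and> fourier g k = 0"] zero by auto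
  have parts_swap: "separated_coeffs (\<lambda>k. F (prod.swap k)) (\<lambda>k. G (prod.swap k)) \<longleftrightarrow>
      (\<forall>k\<in>pos_freqs. fst k \<noteq> 0 \<longrightarrow> F k = 0 \<and> G k = 0) \<and>
      (\<forall>k\<in>pos_freqs - {0}. snd k \<noteq> 0 \<longrightarrow> F (- k) = 0 \<and> G (- k) = 0)" for F G
  proof -
    have "separated_coeffs (\<lambda>k. F (prod.swap k)) (\<lambda>k. G (prod.swap k)) \<longleftrightarrow>
      (\<forall>k\<in>pos_freqs. (fst k \<noteq> 0 \<longrightarrow> F k = 0 \<and> G k = 0) \<and> (snd k \<noteq> 0 \<longrightarrow> F (- k) = 0 \<and> G (- k) = 0))"
      unfolding swap[symmetric, of "\<lambda>k. (fst k \<noteq> 0 \<longrightarrow> F k = 0 \<and> G k = 0) \<and> (snd k \<noteq> 0 \<longrightarrow> F (- k) = 0 \<and> G (- k) = 0)"]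
      by (simp add: separated_coeffs_def swap_uminus)
    also have "\<dots> \<longleftrightarrow> (\<forall>k\<in>pos_freqs. fst k \<noteq> 0 \<longrightarrow> F k = 0 \<and> G k = 0) \<and>
      (\<forall>k\<in>pos_freqs - {0}. snd k \<noteq> 0 \<longrightarrow> F (- k) = 0 \<and> G (- k) = 0)"
      using nonzero by blast
    finally show ?thesis .
  qed
  show ?B
    unfolding parts_swap depends_only_on_z2_iff[OF plus_part_fourier(1)[OF assms(1)]]
      depends_only_on_z2_iff[OF plus_part_fourier(1)[OF assms(2)]]
      depends_only_on_z1_iff[OF minus_part_fourier(1)[OF assms(1)]]
      depends_only_on_z1_iff[OF minus_part_fourier(1)[OF assms(2)]]
      plus_part_fourier(2)[OF assms(1)] plus_part_fourier(2)[OF assms(2)]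
      minus_part_fourier(2)[OF assms(1)] minus_part_fourier(2)[OF assms(2)]
    using neg[of "\<lambda>k. snd k \<noteq> 0 \<longrightarrow> fourier f k = 0 \<and> fourier g k = 0"] zero by auto
qed

text \<open>The combination minus the constant \<open>\<alpha> F 0 + \<beta> G 0\<close> lies in the closed span of the
  characters in \<open>plh_freqs\<close>, so it vanishes iff its coefficients do.\<close>

lemma dependent_coeffs_iff:
  assumes "f \<in> plh_hardy2" "g \<in> plh_hardy2"
  shows "dependent_coeffs (fourier f) (fourier g) \<longleftrightarrow>
    (\<exists>\<alpha> \<beta> c :: complex. \<not> (\<alpha> = 0 \<and> \<beta> = 0) \<and> (AE z in torus_measure. \<alpha> * f z + \<beta> * g z = c))"
proof -
  have const: "(\<lambda>z. c) = (\<lambda>z. c * character 0 z)" for c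
    by (simp add: character_def)
  have const_spectral: "(\<lambda>z. c) \<in> spectral plh_freqs" for c
    unfolding const[of c] by (intro spectral_cmult character_spectral) (simp add: mem_plh_freqs)
  have const_fourier: "fourier (\<lambda>z. c) k = c * of_bool (k = 0)" for c k
    unfolding const[of c] by (simp only: fourier_cmult fourier_character)
  have comb: "(\<lambda>z. \<alpha> * f z + \<beta> * g z) \<in> spectral plh_freqs" for \<alpha> \<beta>
    by (intro spectral_add spectral_cmult plh_hardy2_spectral assms)
  have comb_fourier: "fourier (\<lambda>z. \<alpha> * f z + \<beta> * g z) k = \<alpha> * fourier f k + \<beta> * fourier g k" for \<alpha> \<beta> k
    by (simp add: fourier_add L2_cmult plh_hardy2_L2 assms fourier_cmult)
  have "(\<forall>k\<in>plh_freqs - {0}. \<alpha> * fourier f k + \<beta> * fourier g k = 0) \<longleftrightarrow>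
      (\<exists>c. AE z in torus_measure. \<alpha> * f z + \<beta> * g z = c)" for \<alpha> \<beta>
  proof
    assume *: "\<forall>k\<in>plh_freqs - {0}. \<alpha> * fourier f k + \<beta> * fourier g k = 0"
    define c where "c = \<alpha> * fourier f 0 + \<beta> * fourier g 0"
    have "AE z in torus_measure. (\<alpha> * f z + \<beta> * g z) - c = 0"
    proof (rule spectral_eq_zero[OF spectral_diff[OF comb const_spectral]])
      show "fourier (\<lambda>z. (\<alpha> * f z + \<beta> * g z) - c) k = 0" if "k \<in> plh_freqs" for k
        using * that by (cases "k = 0")
          (auto simp: fourier_diff spectral_L2[OF comb] spectral_L2[OF const_spectral] comb_fourier const_fourier c_def)
    qed
    then show "\<exists>c. AE z in torus_measure. \<alpha> * f z + \<beta> * g z = c" by (intro exI[of _ c]) simp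
  next
    assume "\<exists>c. AE z in torus_measure. \<alpha> * f z + \<beta> * g z = c"
    then obtain c where "AE z in torus_measure. \<alpha> * f z + \<beta> * g z = c" by blast
    from fourier_cong_AE[OF this spectral_L2[OF comb]]
    show "\<forall>k\<in>plh_freqs - {0}. \<alpha> * fourier f k + \<beta> * fourier g k = 0"
      by (auto simp: comb_fourier const_fourier)
  qed
  then show ?thesis unfolding dependent_coeffs_def by auto
qed

section \<open>The characterization of commuting Toeplitz operators\<close>

theorem theorem1p7:
  fixes f g :: "complex \<times> complex \<Rightarrow> complex"
  assumes "f \<in> plh_hardy2" "f \<in> Linf torus_measure"
    and "g \<in> plh_hardy2" "g \<in> Linf torus_measure"
  shows "(\<forall>h\<in>plh_hardy2. AE z in torus_measure.
            toeplitz f (toeplitz g h) z = toeplitz g (toeplitz f h) z) \<longleftrightarrow>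
         (depends_only_on_z1 (plus_part f) \<and> depends_only_on_z1 (plus_part g) \<and>
          depends_only_on_z2 (minus_part f) \<and> depends_only_on_z2 (minus_part g)) \<or>
         (depends_only_on_z2 (plus_part f) \<and> depends_only_on_z2 (plus_part g) \<and>
          depends_only_on_z1 (minus_part f) \<and> depends_only_on_z1 (minus_part g)) \<or>
         (\<exists>\<alpha> \<beta> c :: complex. \<not> (\<alpha> = 0 \<and> \<beta> = 0) \<and>
            (AE z in torus_measure. \<alpha> * f z + \<beta> * g z = c))"
  unfolding separated_coeffs_iff[OF assms(1,3), symmetric] dependent_coeffs_iff[OF assms(1,3), symmetric]
  using commuting_coeffs_classification[OF commuting_toeplitz_coeffs[OF assms]]
    toeplitz_commute_if_separated[OF assms] toeplitz_commute_if_dependent[OF assms]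
  by blast

end
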